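(* Let $m\in\mathbb N$, let $B$ be a real skew-symmetric $m\times m$ matrix with trivial kernel, and let $\mathcal G$ be the associated step-two group (see context) with $Q=m+2$. Let $p\ge2$, $\theta\in\mathbb R$, and let $\rho_B(z,t)=(|z|_B^4+t^2)^{1/4}$ with $|z|_B=\tfrac12\sqrt{\langle z,(-B^2)^{1/2}z\rangle}$. Let $\lambda_{\min}(B)$ be the smallest eigenvalue of the symmetric positive definite matrix $(-B^2)^{1/2}$. Then \[ c(\rho_B,p,\theta)\ge\begin{cases}\left(\frac{\lambda_{\min}(B)}{4}\right)^{p/2}\left|\frac{Q-p\theta}{p}\right|^p\left|\frac{Q-2}{Q}\right|^p & \text{if } p\theta\in\left[\left(1-\sqrt{\tfrac32}\right)Q,\left(1+\sqrt{\tfrac32}\right)Q\right],\\[1ex] \left(\frac{\lambda_{\min}(B)}{4}\right)^{p/2}\left(\frac32\right)^{p/2}\frac{\left(3p\theta(p\theta-2Q)\right)^{p/4}}{|p\theta-Q|^{p/2}}\left|\frac{Q-2}{p}\right|^p & \text{otherwise.}\end{cases} \] In particular, $c(\rho_B,2,1)\ge\frac{\lambda_{\min}(B)}{4}\,\frac{(Q-2)^4}{4Q^2}$.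
   Context: $\mathcal G$ is $\mathbb R^m\times\mathbb R$ with coordinates $(z,t)$ and group law $(z,t)\circ(\eta,\tau)=(z+\eta,t+\tau+\tfrac12\langle Bz,\eta\rangle)$, dilations $\delta_\gamma(z,t)=(\gamma z,\gamma^2t)$, $Q=m+2$. Horizontal vector fields $X_i=\partial_{z_i}+\tfrac12(Bz)_i\partial_t$, $\nabla_{\mathcal G}u=(X_1u,\dots,X_mu)$ with Euclidean norm. For a positive homogeneous $d$ (continuous, $d(\delta_\lambda(z,t))=\lambda d(z,t)$ for $\lambda>0$, $d>0$ off the origin), $p\ge2$, $\theta\in\mathbb R$, \[ c(d,p,\theta)=\sup\Big\{c\ge0:\int_{\mathcal G}\frac{|\nabla_{\mathcal G}u|^p}{d^{p(\theta-1)}}dz\,dt\ge c\int_{\mathcal G}\frac{|u|^p}{d^{p\theta}}dz\,dt\ \ \forall u\in C_c^\infty(\mathcal G\setminus\{0\})\Big\}. \] *)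

theory Defs
  imports "HOL-Analysis.Analysis"
begin

definition grp_mult :: "real^'m^'m \<Rightarrow> ((real^'m) \<times> real) \<Rightarrow> ((real^'m) \<times> real) \<Rightarrow> ((real^'m) \<times> real)" where
  "grp_mult B x y = (fst x + fst y, snd x + snd y + (1/2) * ((B *v fst x) \<bullet> fst y))"

definition grp_dil :: "real \<Rightarrow> ((real^'m) \<times> real) \<Rightarrow> ((real^'m) \<times> real)" where
  "grp_dil g x = (g *\<^sub>R fst x, g^2 * snd x)"

fun iter_deriv :: "('a::real_normed_vector \<Rightarrow> real) \<Rightarrow> 'a list \<Rightarrow> 'a \<Rightarrow> real" where
  "iter_deriv f [] = f"
| "iter_deriv f (v # vs) = (\<lambda>x. frechet_derivative (iter_deriv f vs) (at x) v)"

definition smooth_fun :: "('a::real_normed_vector \<Rightarrow> real) \<Rightarrow> bool" where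
  "smooth_fun f \<longleftrightarrow> (\<forall>vs x. iter_deriv f vs differentiable (at x))"

definition test_funs :: "(((real^'m) \<times> real) \<Rightarrow> real) set" where
  "test_funs = {u. smooth_fun u \<and> compact (closure {x. u x \<noteq> 0})
                   \<and> (0::(real^'m) \<times> real) \<notin> closure {x. u x \<noteq> 0}}"

definition horiz_field :: "real^'m^'m \<Rightarrow> 'm \<Rightarrow> (((real^'m) \<times> real) \<Rightarrow> real) \<Rightarrow> ((real^'m) \<times> real) \<Rightarrow> real" where
  "horiz_field B i u x =
     frechet_derivative u (at x) (axis i 1, (1/2) * (B *v fst x) $ i)"

definition horiz_grad :: "real^'m^'m \<Rightarrow> (((real^'m) \<times> real) \<Rightarrow> real) \<Rightarrow> ((real^'m) \<times> real) \<Rightarrow> real^'m" where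
  "horiz_grad B u x = (\<chi> i. horiz_field B i u x)"

definition pos_homogeneous :: "(((real^'m) \<times> real) \<Rightarrow> real) \<Rightarrow> bool" where
  "pos_homogeneous d \<longleftrightarrow> continuous_on UNIV d
     \<and> (\<forall>l>0. \<forall>x. d (grp_dil l x) = l * d x) \<and> (\<forall>x. x \<noteq> 0 \<longrightarrow> d x > 0)"

definition hardy_const :: "real^'m^'m \<Rightarrow> (((real^'m) \<times> real) \<Rightarrow> real) \<Rightarrow> real \<Rightarrow> real \<Rightarrow> ereal" where
  "hardy_const B d p \<theta> = Sup {ereal c | c. c \<ge> 0 \<and>
     (\<forall>u\<in>test_funs.
        (\<integral>\<^sup>+ x. ennreal (norm (horiz_grad B u x) powr p / d x powr (p * (\<theta> - 1))) \<partial>lborel)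
        \<ge> ennreal c * (\<integral>\<^sup>+ x. ennreal (\<bar>u x\<bar> powr p / d x powr (p * \<theta>)) \<partial>lborel))}"

definition skew_symmetric :: "real^'m^'m \<Rightarrow> bool" where
  "skew_symmetric B \<longleftrightarrow> transpose B = - B"

definition pos_semidef :: "real^'m^'m \<Rightarrow> bool" where
  "pos_semidef S \<longleftrightarrow> transpose S = S \<and> (\<forall>v. v \<bullet> (S *v v) \<ge> 0)"

definition matrix_sqrt :: "real^'m^'m \<Rightarrow> real^'m^'m" where
  "matrix_sqrt A = (THE S. pos_semidef S \<and> S ** S = A)"

definition eigenvalues :: "real^'m^'m \<Rightarrow> real set" where
  "eigenvalues S = {l. \<exists>v. v \<noteq> 0 \<and> S *v v = l *\<^sub>R v}"

definition lambda_min :: "real^'m^'m \<Rightarrow> real" where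
  "lambda_min B = Min (eigenvalues (matrix_sqrt (- (B ** B))))"

definition normB :: "real^'m^'m \<Rightarrow> real^'m \<Rightarrow> real" where
  "normB B z = (1/2) * sqrt (z \<bullet> (matrix_sqrt (- (B ** B)) *v z))"

definition rhoB :: "real^'m^'m \<Rightarrow> ((real^'m) \<times> real) \<Rightarrow> real" where
  "rhoB B x = (normB B (fst x) ^ 4 + (snd x)^2) powr (1/4)"

end

theory Submission
  imports Defs
begin

text \<open>
  Let \<open>S = (-B\<^sup>2)\<^sup>1\<^sup>/\<^sup>2\<close>, let \<open>J = S\<^sup>-\<^sup>1 B\<close> (a skew isometry commuting with \<open>S\<close>), and write
  \<open>r = |z|\<^sub>B\<^sup>2\<close>, \<open>P = r\<^sup>2 + t\<^sup>2\<close>, the fourth power of the gauge \<open>\<rho>\<close>, and \<open>b = p\<theta>\<close>. The horizontal vector field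
  \<open>F = \<rho>\<^sup>-\<^sup>b z + s \<rho>\<^sup>-\<^sup>b\<^sup>-\<^sup>4 r (r z + t J z)\<close> with \<open>s = b / (Q - b)\<close> has horizontal divergence exactly
  \<open>(Q - 2) \<rho>\<^sup>-\<^sup>b\<close>, while \<open>|F|\<^sup>2 \<le> (4 / \<lambda>) M \<rho>\<^sup>2\<^sup>-\<^sup>2\<^sup>b\<close>, where \<open>\<lambda>\<close> is the least eigenvalue of \<open>S\<close> and \<open>M\<close> is the
  maximum over \<open>y = r / \<rho>\<^sup>2\<close> in \<open>[0, 1]\<close> of \<open>y (1 + (2 s + s\<^sup>2) y\<^sup>2)\<close>. Integrating the divergence of \<open>|u|\<^sup>p F\<close>
  and applying Young's inequality with the optimal weight gives the Hardy constant
  \<open>((Q - 2) / (p \<surd>(4 M / \<lambda>)))\<^sup>p\<close>. The cubic attains its maximum at \<open>y = 1\<close> if \<open>2 s + s\<^sup>2 \<ge> -1/3\<close> and at an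
  interior critical point otherwise, which are the two cases of the theorem.
\<close>

subsection \<open>Square roots of positive semidefinite matrices\<close>

text \<open>The first variation vanishes at a maximiser of \<open>x \<bullet> f x\<close> on the
  unit sphere of \<open>V\<close>, which makes it an eigenvector. The subspace \<open>V\<close> is
  kept general so that the result applies to the orthogonal complement of eigenvectors already
  found.\<close>

lemma selfadjoint_has_eigenvector:
  fixes f :: "'a::euclidean_space \<Rightarrow> 'a"
  assumes lin: "linear f" and sa: "\<And>x y. f x \<bullet> y = x \<bullet> f y"
    and V: "subspace V" and inv: "\<And>x. x \<in> V \<Longrightarrow> f x \<in> V" and nz: "\<exists>x\<in>V. x \<noteq> 0"
  obtains v \<mu> where "v \<in> V" "norm v = 1" "f v = \<mu> *\<^sub>R v"
proof -
  let ?K = "sphere 0 1 \<inter> V"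
  have "compact ?K"
    by (intro compact_Int_closed compact_sphere closed_subspace V)
  moreover have "?K \<noteq> {}"
  proof -
    obtain x where "x \<in> V" "x \<noteq> 0" using nz by blast
    then have "(1 / norm x) *\<^sub>R x \<in> ?K"
      using V by (simp add: subspace_scale)
    then show ?thesis by blast
  qed
  moreover have "continuous_on ?K (\<lambda>x. x \<bullet> f x)"
    by (intro continuous_intros linear_continuous_on_compose[OF continuous_on_id lin])
  ultimately obtain v where v: "v \<in> ?K" and max: "\<And>w. w \<in> ?K \<Longrightarrow> w \<bullet> f w \<le> v \<bullet> f v"
    by (metis continuous_attains_sup)
  define \<mu> where "\<mu> = v \<bullet> f v"
  have vV: "v \<in> V" and nv: "norm v = 1" using v by auto
  define q where "q w = \<mu> * (w \<bullet> w) - w \<bullet> f w" for w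
  have q: "q w \<ge> 0" if "w \<in> V" for w
  proof (cases "w = 0")
    case True
    then show ?thesis by (simp add: q_def linear_0[OF lin])
  next
    case False
    have "(1 / norm w) *\<^sub>R w \<in> ?K"
      using V that False by (simp add: subspace_scale)
    from max[OF this] have "(w \<bullet> f w) / (norm w)^2 \<le> \<mu>"
      by (simp add: \<mu>_def linear_scale[OF lin] power2_eq_square)
    then show ?thesis
      using False by (simp add: q_def dot_square_norm divide_le_eq)
  qed
  \<comment> \<open>Half the gradient of \<open>q\<close> at its zero \<open>v\<close>. Invariance
    keeps it in \<open>V\<close>, so \<open>q\<close> stays nonnegative along this
    direction.\<close>
  define y where "y = \<mu> *\<^sub>R v - f v"
  have yV: "y \<in> V"
    unfolding y_def by (intro subspace_diff subspace_scale V vV inv)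
  have expand: "q (v + e *\<^sub>R y) = 2 * e * (y \<bullet> y) + e^2 * q y" for e
  proof -
    have "q (v + e *\<^sub>R y) = q v + e * (2 * (\<mu> * (v \<bullet> y)) - y \<bullet> f v - v \<bullet> f y) + e^2 * q y"
      by (simp add: q_def linear_add[OF lin] linear_scale[OF lin] inner_add_left inner_add_right
          inner_commute algebra_simps power2_eq_square)
    moreover have "q v = 0"
      using nv by (simp add: q_def \<mu>_def dot_square_norm)
    moreover have "v \<bullet> f y = y \<bullet> f v"
      using sa[of v y] by (simp add: inner_commute)
    moreover have "y \<bullet> y = \<mu> * (v \<bullet> y) - y \<bullet> f v"
      by (subst (2) y_def) (simp add: inner_diff_right inner_commute)
    ultimately show ?thesis by (simp add: mult.assoc)
  qed
  have "y \<bullet> y = 0"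
  proof (rule ccontr)
    assume "y \<bullet> y \<noteq> 0"
    then have pos: "y \<bullet> y > 0" using inner_ge_zero[of y] by linarith
    have qy: "q y \<ge> 0" using q yV by blast
    \<comment> \<open>A negative step so short that the quadratic term \<open>e^2 * q y\<close>
      cannot outweigh the linear one; \<open>q\<close> would then be negative at a point of
      \<open>V\<close>.\<close>
    define e where "e = - (y \<bullet> y) / (1 + q y)"
    have "e < 0" using pos qy by (simp add: e_def)
    have "2 * (y \<bullet> y) + e * q y > 0"
    proof -
      have "- e * q y \<le> y \<bullet> y"
        using pos qy by (simp add: e_def divide_le_eq algebra_simps)
      then show ?thesis using pos by linarith
    qed
    then have "e * (2 * (y \<bullet> y) + e * q y) < 0"
      using \<open>e < 0\<close> by (simp add: mult_neg_pos)
    then have "q (v + e *\<^sub>R y) < 0"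
      by (simp add: expand algebra_simps power2_eq_square)
    moreover have "v + e *\<^sub>R y \<in> V"
      by (intro subspace_add subspace_scale V vV yV)
    ultimately show False using q by fastforce
  qed
  then have "f v = \<mu> *\<^sub>R v" by (simp add: y_def)
  with vV nv show ?thesis using that by blast
qed

text \<open>An orthonormal set of eigenvectors of maximal cardinality must span: its orthogonal
  complement is invariant under \<open>f\<close> by self-adjointness, and if nonzero it would supply
  one more eigenvector.\<close>

lemma selfadjoint_orthonormal_eigenbasis:
  fixes f :: "'a::euclidean_space \<Rightarrow> 'a"
  assumes lin: "linear f" and sa: "\<And>x y. f x \<bullet> y = x \<bullet> f y"
  obtains E \<mu> where "finite E" "pairwise orthogonal E" "\<And>e. e \<in> E \<Longrightarrow> norm e = 1"
    "span E = UNIV" "\<And>e. e \<in> E \<Longrightarrow> f e = \<mu> e *\<^sub>R e"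
proof -
  define ok where "ok E \<longleftrightarrow> pairwise orthogonal E \<and> (\<forall>e\<in>E. norm e = 1 \<and> (\<exists>\<mu>. f e = \<mu> *\<^sub>R e))" for E
  have ok_fin: "finite E \<and> card E \<le> DIM('a)" if "ok E" for E
  proof -
    have "pairwise orthogonal E" "0 \<notin> E" using that by (auto simp: ok_def)
    then show ?thesis
      using pairwise_orthogonal_independent independent_bound by blast
  qed
  obtain E where E: "ok E" and maxE: "\<And>E'. ok E' \<Longrightarrow> card E' \<le> card E"
  proof -
    have "ok {}" by (simp add: ok_def)
    then have "\<exists>E. ok E \<and> (\<forall>E'. ok E' \<longrightarrow> card E' \<le> card E)"
      by (rule ex_has_greatest_nat[where b = "Suc DIM('a)"]) (use ok_fin in \<open>auto simp: less_Suc_eq_le\<close>)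
    then show ?thesis using that by blast
  qed
  have spanE: "span E = UNIV"
  proof (rule ccontr)
    assume "span E \<noteq> UNIV"
    then have "span E \<subset> span UNIV" by auto
    from orthogonal_to_subspace_exists_gen[OF this]
    obtain x where x: "x \<noteq> 0" "\<And>y. y \<in> span E \<Longrightarrow> orthogonal x y" by blast
    let ?V = "{x. \<forall>e\<in>E. e \<bullet> x = 0}"
    have "subspace ?V"
      by (auto simp: subspace_def inner_add_right)
    moreover have "f w \<in> ?V" if "w \<in> ?V" for w
    proof -
      have "e \<bullet> f w = 0" if "e \<in> E" for e
      proof -
        have "\<exists>\<mu>. f e = \<mu> *\<^sub>R e" using E \<open>e \<in> E\<close> by (simp add: ok_def)
        then obtain \<mu> where \<mu>: "f e = \<mu> *\<^sub>R e" ..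
        have "e \<bullet> w = 0" using \<open>w \<in> ?V\<close> \<open>e \<in> E\<close> by simp
        then show ?thesis using sa[of e w] by (simp add: \<mu>)
      qed
      then show ?thesis by simp
    qed
    moreover have "\<exists>x\<in>?V. x \<noteq> 0"
      using x by (intro bexI[of _ x]) (auto simp: orthogonal_def inner_commute span_base)
    ultimately obtain v \<mu> where v: "v \<in> ?V" "norm v = 1" "f v = \<mu> *\<^sub>R v"
      by (rule selfadjoint_has_eigenvector[OF lin sa])
    have "v \<notin> E"
      using v by auto
    have "ok (insert v E)"
      using E v by (auto simp: ok_def pairwise_insert orthogonal_def inner_commute)
    moreover have "card (insert v E) = Suc (card E)"
      using ok_fin[OF E] \<open>v \<notin> E\<close> by simp
    ultimately show False using maxE by fastforce
  qed
  have "finite E" "pairwise orthogonal E" "\<And>e. e \<in> E \<Longrightarrow> norm e = 1"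
    using ok_fin[OF E] E unfolding ok_def by blast+
  have "\<forall>e\<in>E. \<exists>\<mu>. f e = \<mu> *\<^sub>R e"
    using E by (simp add: ok_def)
  then obtain \<mu> where \<mu>: "\<forall>e\<in>E. f e = \<mu> e *\<^sub>R e"
    by (rule bchoice[THEN exE])
  show ?thesis
    by (rule that[of E \<mu>]) (fact | use \<mu> in blast)+
qed

lemma matrix_vector_mult_minus_left: "(- A) *v x = - (A *v x)" for A :: "real^'n^'m"
  by (simp add: matrix_vector_mult_def vec_eq_iff sum_negf)

lemma matrix_vector_mult_minus_right: "A *v (- x) = - (A *v x)" for A :: "real^'n^'m"
  by (simp add: matrix_vector_mult_def vec_eq_iff sum_negf)

text \<open>As a rewrite rule it replaces \<open>transpose A *v x\<close> by \<open>x v* A\<close>,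
  whereas the adjoint identities below are phrased with \<open>transpose A *v x\<close>.\<close>

declare transpose_matrix_vector [simp del]

lemma inner_matrix_vector_mult_left:
  fixes A :: "real^'m^'m"
  shows "(A *v x) \<bullet> y = x \<bullet> (transpose A *v y)"
  by (metis dot_lmul_matrix inner_commute transpose_matrix_vector)

lemma inner_skew_symmetric:
  fixes B :: "real^'m^'m"
  assumes "skew_symmetric B"
  shows "(B *v x) \<bullet> y = - (x \<bullet> (B *v y))"
  using inner_matrix_vector_mult_left[of B x y] assms
  unfolding skew_symmetric_def by (simp add: matrix_vector_mult_minus_left)

text \<open>For \<open>\<mu> > 0\<close>, factoring \<open>R^2 - \<mu>\<close> shows that
  \<open>y = R *v e - sqrt \<mu> *\<^sub>R e\<close> satisfies
  \<open>R *v y = - sqrt \<mu> *\<^sub>R y\<close>, and semidefiniteness forces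
  \<open>y = 0\<close>. Both the uniqueness of the square root and its commuting with
  \<open>B\<close> rest on this.\<close>

lemma pos_semidef_sqrt_eigenvector:
  fixes R :: "real^'m^'m"
  assumes R: "pos_semidef R" and e: "(R ** R) *v e = \<mu> *\<^sub>R e"
  shows "R *v e = sqrt \<mu> *\<^sub>R e"
proof (cases "e = 0")
  case False
  have sym: "(R *v x) \<bullet> y = x \<bullet> (R *v y)" for x y
    using R inner_matrix_vector_mult_left[of R x y] by (simp add: pos_semidef_def)
  have psd: "x \<bullet> (R *v x) \<ge> 0" for x using R by (simp add: pos_semidef_def)
  have RR: "R *v (R *v e) = \<mu> *\<^sub>R e" using e by (simp add: matrix_vector_mul_assoc)
  have n: "(R *v e) \<bullet> (R *v e) = \<mu> * (e \<bullet> e)"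
    by (simp add: sym RR)
  then have "\<mu> * (e \<bullet> e) \<ge> 0" by (metis inner_ge_zero)
  then have \<mu>: "\<mu> \<ge> 0" using False inner_gt_zero_iff[of e] by (metis zero_le_mult_iff not_less)
  show ?thesis
  proof (cases "\<mu> = 0")
    case True
    then show ?thesis using n by simp
  next
    case False
    define y where "y = R *v e - sqrt \<mu> *\<^sub>R e"
    have "R *v y = - sqrt \<mu> *\<^sub>R y"
      using \<mu> by (simp add: y_def RR matrix_vector_mult_diff_distrib matrix_vector_mult_scaleR
          algebra_simps)
    then have "- sqrt \<mu> * (y \<bullet> y) \<ge> 0" using psd[of y] by simp
    then have "y \<bullet> y \<le> 0" using False \<mu> by (simp add: mult_le_0_iff)
    then have "y = 0" using inner_gt_zero_iff[of y] by linarith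
    then show ?thesis by (simp add: y_def)
  qed
qed (simp add: matrix_vector_mult_0_right)

text \<open>Scaling each eigenvector by the square root of its eigenvalue gives one root. Any
  semidefinite root acts in the same way on the eigenbasis, so the \<open>THE\<close> in
  \<open>matrix_sqrt\<close> is well defined.\<close>

lemma pos_semidef_eigenbasis_matrix_sqrt:
  fixes A :: "real^'m^'m"
  assumes A: "pos_semidef A"
  obtains E \<mu> where "finite E" "pairwise orthogonal E" "\<And>e. e \<in> E \<Longrightarrow> norm e = 1"
    "span E = UNIV" "\<And>e. e \<in> E \<Longrightarrow> A *v e = \<mu> e *\<^sub>R e"
    "\<And>e. e \<in> E \<Longrightarrow> matrix_sqrt A *v e = sqrt (\<mu> e) *\<^sub>R e"
    "pos_semidef (matrix_sqrt A)" "matrix_sqrt A ** matrix_sqrt A = A"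
proof -
  have sym: "(A *v x) \<bullet> y = x \<bullet> (A *v y)" for x y
    using A inner_matrix_vector_mult_left[of A x y] by (simp add: pos_semidef_def)
  obtain E \<mu> where E: "finite E" "pairwise orthogonal E" "\<And>e. e \<in> E \<Longrightarrow> norm e = 1"
    "span E = UNIV" "\<And>e. e \<in> E \<Longrightarrow> A *v e = \<mu> e *\<^sub>R e"
    using selfadjoint_orthonormal_eigenbasis[OF matrix_vector_mul_linear sym] by metis
  have \<mu>: "\<mu> e \<ge> 0" if "e \<in> E" for e
  proof -
    have "0 \<le> e \<bullet> (A *v e)" using A by (simp add: pos_semidef_def)
    then show ?thesis using E(3,5)[OF that] by (simp add: dot_square_norm)
  qed
  define g where "g x = (\<Sum>e\<in>E. (sqrt (\<mu> e) * (x \<bullet> e)) *\<^sub>R e)" for x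
  have "linear g"
    by (rule linearI) (simp_all add: g_def inner_add_left algebra_simps sum.distrib scaleR_sum_right)
  define S where "S = matrix g"
  have Sv: "S *v x = g x" for x
    unfolding S_def using \<open>linear g\<close> by (simp add: matrix_works)
  have ge: "g e = sqrt (\<mu> e) *\<^sub>R e" if "e \<in> E" for e
  proof -
    have "e \<bullet> e' = (if e' = e then 1 else 0)" if "e' \<in> E" for e'
      using E(2,3) \<open>e \<in> E\<close> that by (auto simp: pairwise_def orthogonal_def dot_square_norm)
    then have "g e = (\<Sum>e'\<in>E. (if e' = e then sqrt (\<mu> e) *\<^sub>R e else 0))"
      unfolding g_def by (intro sum.cong) auto
    then show ?thesis using E(1) that by simp
  qed
  have eqI: "M = N" if "\<And>e. e \<in> E \<Longrightarrow> M *v e = N *v e" for M N :: "real^'m^'m"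
  proof -
    have "M *v x = N *v x" for x
      by (rule linear_eq_on_span[OF matrix_vector_mul_linear matrix_vector_mul_linear, of E])
        (use that E(4) in auto)
    then show ?thesis by (simp add: matrix_eq)
  qed
  have SS: "S ** S = A"
    by (rule eqI) (use E(5) \<mu> in \<open>simp add: matrix_vector_mul_assoc[symmetric] Sv ge
        linear_scale[OF \<open>linear g\<close>]\<close>)
  have gsym: "g x \<bullet> y = x \<bullet> g y" for x y
    by (simp add: g_def inner_sum_left inner_sum_right inner_commute mult_ac)
  have "transpose S = S"
  proof -
    have "transpose S *v y = S *v y" for y
    proof (rule vector_eq_rdot[THEN iffD1], rule allI)
      fix x show "(transpose S *v y) \<bullet> x = (S *v y) \<bullet> x"
        using inner_matrix_vector_mult_left[of "transpose S" y x] 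
        by (simp add: transpose_transpose Sv gsym)
    qed
    then show ?thesis by (simp add: matrix_eq)
  qed
  moreover have "x \<bullet> (S *v x) \<ge> 0" for x
    unfolding Sv g_def inner_sum_right
    by (rule sum_nonneg) (simp add: \<mu> inner_commute mult.assoc)
  ultimately have S: "pos_semidef S" by (simp add: pos_semidef_def)
  have uniq: "R = S" if "pos_semidef R" "R ** R = A" for R
    by (rule eqI) (use pos_semidef_sqrt_eigenvector[OF that(1)] that(2) E(5) ge Sv in auto)
  have "matrix_sqrt A = S"
    unfolding matrix_sqrt_def by (rule the_equality) (use S SS in blast, use uniq in blast)
  then show ?thesis using that[of E \<mu>] E S SS Sv ge by simp
qed

section \<open>The square root of \<open>- (B ** B)\<close> and the complex structure\<close>

text \<open>Since \<open>B\<close> preserves each eigenspace of \<open>- (B ** B)\<close>, it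
  commutes with \<open>S\<close>. The spectrum of \<open>S\<close> is the finite nonempty set of the
  \<open>sqrt (\<mu> e)\<close>, so \<open>Min\<close> in \<open>lambda_min\<close> is meaningful;
  the trivial kernel makes it positive, and the quadratic form is compared term by term in the
  eigenbasis.\<close>

lemma sqrt_neg_skew_square:
  fixes B :: "real^'m^'m"
  assumes skew: "skew_symmetric B" and ker: "\<forall>z. B *v z = 0 \<longrightarrow> z = 0"
  defines "S \<equiv> matrix_sqrt (- (B ** B))"
  shows "pos_semidef S" "S ** S = - (B ** B)" "S ** B = B ** S"
    "lambda_min B > 0" "lambda_min B * (z \<bullet> z) \<le> z \<bullet> (S *v z)"
proof -
  have Bsk: "(B *v x) \<bullet> y = - (x \<bullet> (B *v y))" for x y
    by (rule inner_skew_symmetric[OF skew])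
  have A: "pos_semidef (- (B ** B))"
  proof -
    have "transpose (- (B ** B)) = - (B ** B)"
    proof (subst matrix_eq, intro allI, rule vector_eq_rdot[THEN iffD1], rule allI)
      fix x y
      show "(transpose (- (B ** B)) *v x) \<bullet> y = (- (B ** B) *v x) \<bullet> y"
        using inner_matrix_vector_mult_left[of "transpose (- (B ** B))" x y]
        by (simp add: matrix_vector_mult_minus_left matrix_vector_mul_assoc[symmetric] Bsk)
    qed
    moreover have "v \<bullet> ((- (B ** B)) *v v) \<ge> 0" for v
      using Bsk[of v "B *v v"]
      apply (simp add: matrix_vector_mult_minus_left matrix_vector_mul_assoc[symmetric])
      using inner_ge_zero[of "B *v v"] by linarith
    ultimately show ?thesis by (simp add: pos_semidef_def)
  qed
  obtain E \<mu> where E: "finite E" "pairwise orthogonal E" "\<And>e. e \<in> E \<Longrightarrow> norm e = 1"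
    "span E = UNIV" "\<And>e. e \<in> E \<Longrightarrow> - (B ** B) *v e = \<mu> e *\<^sub>R e"
    "\<And>e. e \<in> E \<Longrightarrow> S *v e = sqrt (\<mu> e) *\<^sub>R e"
    and S: "pos_semidef S" "S ** S = - (B ** B)"
    using pos_semidef_eigenbasis_matrix_sqrt[OF A] unfolding S_def by metis
  show "pos_semidef S" "S ** S = - (B ** B)" by fact+
  show "S ** B = B ** S"
  proof -
    have "S *v (B *v x) = B *v (S *v x)" for x
    proof (rule linear_eq_on_span[of "\<lambda>x. S *v (B *v x)" "\<lambda>x. B *v (S *v x)" E])
      fix e assume e: "e \<in> E"
      have "(S ** S) *v (B *v e) = B *v ((- (B ** B)) *v e)"
        by (simp add: S(2) matrix_vector_mult_minus_left matrix_vector_mul_assoc[symmetric])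
          (metis matrix_vector_mult_minus_right)
      also have "\<dots> = \<mu> e *\<^sub>R (B *v e)" by (simp add: E(5)[OF e] matrix_vector_mult_scaleR)
      finally have "S *v (B *v e) = sqrt (\<mu> e) *\<^sub>R (B *v e)"
        by (rule pos_semidef_sqrt_eigenvector[OF S(1)])
      then show "S *v (B *v e) = B *v (S *v e)"
        by (simp add: E(6)[OF e] matrix_vector_mult_scaleR)
    qed (use E(4) in \<open>auto intro!: linearI simp: matrix_vector_right_distrib matrix_vector_mult_scaleR\<close>)
    then show ?thesis by (simp add: matrix_eq matrix_vector_mul_assoc[symmetric])
  qed
  have Sexp: "S *v x = (\<Sum>e\<in>E. (sqrt (\<mu> e) * (x \<bullet> e)) *\<^sub>R e)" for x
  proof -
    have "x = (\<Sum>e\<in>E. (x \<bullet> e) *\<^sub>R e)"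
      using orthonormal_basis_expand[OF E(2,3) _ E(1), of x] E(4) by simp
    then have "S *v x = S *v (\<Sum>e\<in>E. (x \<bullet> e) *\<^sub>R e)" by simp
    also have "\<dots> = (\<Sum>e\<in>E. S *v ((x \<bullet> e) *\<^sub>R e))"
      using linear_sum[OF matrix_vector_mul_linear[of S]] by blast
    finally show ?thesis
      using E(6) by (simp add: matrix_vector_mult_scaleR mult.commute cong: sum.cong)
  qed
  have inj: "S *v v \<noteq> 0" if "v \<noteq> 0" for v
  proof
    assume "S *v v = 0"
    then have "(S ** S) *v v = 0" by (simp add: matrix_vector_mul_assoc[symmetric])
    then have "B *v (B *v v) = 0"
      by (simp add: S(2) matrix_vector_mult_minus_left matrix_vector_mul_assoc[symmetric])
    then show False using ker that by blast
  qed
  have ev: "eigenvalues S = (\<lambda>e. sqrt (\<mu> e)) ` E"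
  proof (intro equalityI subsetI)
    fix l assume "l \<in> eigenvalues S"
    then obtain v where v: "v \<noteq> 0" "S *v v = l *\<^sub>R v" by (auto simp: eigenvalues_def)
    \<comment> \<open>A nonzero vector has a nonzero component along some \<open>e\<close>; pairing
      the eigenvalue equation with this \<open>e\<close> identifies \<open>l\<close>.\<close>
    have "\<exists>e\<in>E. v \<bullet> e \<noteq> 0"
    proof (rule ccontr)
      assume "\<not> ?thesis"
      then have "(\<Sum>e\<in>E. (v \<bullet> e) *\<^sub>R e) = 0" by (intro sum.neutral) simp
      then show False
        using orthonormal_basis_expand[OF E(2,3) _ E(1), of v] E(4) v by simp
    qed
    then obtain e where e: "e \<in> E" "v \<bullet> e \<noteq> 0" by blast
    have "(S *v v) \<bullet> e = v \<bullet> (S *v e)"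
      using inner_matrix_vector_mult_left[of S v e] S(1) by (simp add: pos_semidef_def)
    then have "l = sqrt (\<mu> e)" using v e E(6) by simp
    then show "l \<in> (\<lambda>e. sqrt (\<mu> e)) ` E" using e by blast
  next
    fix l assume "l \<in> (\<lambda>e. sqrt (\<mu> e)) ` E"
    then obtain e where "e \<in> E" "l = sqrt (\<mu> e)" by blast
    moreover have "e \<noteq> 0" using E(3)[OF \<open>e \<in> E\<close>] by auto
    ultimately show "l \<in> eigenvalues S" using E(6)[of e] unfolding eigenvalues_def by blast
  qed
  have "E \<noteq> {}"
  proof
    assume "E = {}"
    then have "(UNIV :: (real^'m) set) = {0}" using E(4) by simp
    then have "axis undefined 1 = (0 :: real^'m)" by blast
    then show False by (simp add: axis_eq_0_iff)
  qed
  have lm: "lambda_min B = Min ((\<lambda>e. sqrt (\<mu> e)) ` E)"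
    by (simp add: lambda_min_def ev[symmetric] S_def)
  have pos: "sqrt (\<mu> e) > 0" if "e \<in> E" for e
  proof -
    have "0 \<le> e \<bullet> (S *v e)" using S(1) by (simp add: pos_semidef_def)
    then have "sqrt (\<mu> e) \<ge> 0" using E(3,6)[OF that] by (simp add: dot_square_norm)
    moreover have "e \<noteq> 0" using E(3)[OF that] by auto
    then have "sqrt (\<mu> e) \<noteq> 0" using inj[of e] E(6)[OF that] by auto
    ultimately show ?thesis by simp
  qed
  show "lambda_min B > 0"
    unfolding lm using E(1) \<open>E \<noteq> {}\<close> pos by (subst Min_gr_iff) auto
  have "z \<bullet> z = (\<Sum>e\<in>E. (z \<bullet> e)^2)"
  proof -
    have "z \<bullet> z = z \<bullet> (\<Sum>e\<in>E. (z \<bullet> e) *\<^sub>R e)"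
      using orthonormal_basis_expand[OF E(2,3) _ E(1), of z] E(4) by simp
    then show ?thesis by (simp add: inner_sum_right power2_eq_square)
  qed
  then have "lambda_min B * (z \<bullet> z) = (\<Sum>e\<in>E. lambda_min B * (z \<bullet> e)^2)"
    by (simp add: sum_distrib_left)
  also have "\<dots> \<le> (\<Sum>e\<in>E. sqrt (\<mu> e) * (z \<bullet> e)^2)"
    using E(1) by (intro sum_mono mult_right_mono) (auto simp: lm)
  also have "\<dots> = z \<bullet> (S *v z)"
    by (simp add: Sexp inner_sum_right power2_eq_square mult_ac)
  finally show "lambda_min B * (z \<bullet> z) \<le> z \<bullet> (S *v z)" .
qed

text \<open>\<open>J\<close> is the orthogonal factor \<open>S\<^sup>-\<^sup>1 B\<close> in the
  polar decomposition of \<open>B\<close>, and its square is minus the identity. The four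
  conclusions are what the divergence and the length of the vector field require.\<close>

lemma ex_complex_structure:
  fixes B S :: "real^'m^'m"
  assumes skew: "skew_symmetric B" and ker: "\<forall>z. B *v z = 0 \<longrightarrow> z = 0"
    and S: "pos_semidef S" "S ** S = - (B ** B)" "S ** B = B ** S"
  obtains J :: "real^'m^'m" where "skew_symmetric J"
    "\<And>z. (J *v z) \<bullet> (J *v z) = z \<bullet> z"
    "\<And>z. (B *v z) \<bullet> (J *v z) = z \<bullet> (S *v z)" "\<And>z. (S *v z) \<bullet> (J *v z) = 0"
proof -
  have Bsk: "(B *v x) \<bullet> y = - (x \<bullet> (B *v y))" for x y
    by (rule inner_skew_symmetric[OF skew])
  have Ssym: "(S *v x) \<bullet> y = x \<bullet> (S *v y)" for x y
    using inner_matrix_vector_mult_left[of S x y] S(1) by (simp add: pos_semidef_def)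
  have "inj ((*v) S)"
  proof (rule linear_injective_0[OF matrix_vector_mul_linear, THEN iffD2], intro allI impI)
    fix v assume "S *v v = 0"
    then have "(S ** S) *v v = 0" by (simp add: matrix_vector_mul_assoc[symmetric])
    then have "B *v (B *v v) = 0"
      by (simp add: S(2) matrix_vector_mult_minus_left matrix_vector_mul_assoc[symmetric])
    then show "v = 0" using ker by blast
  qed
  then obtain T where T: "T ** S = mat 1"
    using matrix_left_invertible_injective by metis
  then have T': "S ** T = mat 1" using matrix_left_right_inverse by blast
  define J where "J = T ** B"
  have SJ: "S *v (J *v x) = B *v x" for x
    by (simp add: J_def matrix_vector_mul_assoc matrix_mul_assoc T' matrix_mul_lid)
  have TS: "T *v (S *v x) = x" for x by (simp add: matrix_vector_mul_assoc T)
  have SB: "S *v (B *v x) = B *v (S *v x)" for x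
    using S(3) by (simp add: matrix_vector_mul_assoc)
  have JS: "J *v (S *v x) = S *v (J *v x)" for x
  proof -
    have "S *v (J *v (S *v x)) = S *v (S *v (J *v x))" by (simp add: SJ SB)
    then show ?thesis by (metis TS)
  qed
  have Jsk: "(J *v x) \<bullet> y = - (x \<bullet> (J *v y))" for x y
  proof -
    \<comment> \<open>Surjectivity of \<open>S\<close> allows the test vector to be written as
      \<open>S *v w\<close>, which reduces the skewness of \<open>J\<close> to that of
      \<open>B\<close>.\<close>
    obtain w where y: "y = S *v w" using T' by (metis matrix_vector_mul_assoc matrix_vector_mul_lid)
    have "(J *v x) \<bullet> y = (S *v (J *v x)) \<bullet> w" by (simp add: y Ssym)
    also have "\<dots> = - (x \<bullet> (B *v w))" by (simp add: SJ Bsk)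
    also have "\<dots> = - (x \<bullet> (J *v y))" by (simp add: y JS SJ)
    finally show ?thesis .
  qed
  have JJ: "J *v (J *v x) = - x" for x
  proof -
    have "S *v (S *v (J *v (J *v x))) = S *v (J *v (S *v (J *v x)))" by (simp add: JS)
    also have "\<dots> = B *v (B *v x)" by (simp add: SJ)
    also have "\<dots> = - ((S ** S) *v x)"
      by (simp add: S(2) matrix_vector_mult_minus_left matrix_vector_mul_assoc)
    also have "\<dots> = S *v (S *v (- x))"
      by (simp add: matrix_vector_mul_assoc matrix_vector_mult_minus_right)
    finally show ?thesis by (metis TS)
  qed
  have Jiso: "(J *v x) \<bullet> (J *v y) = x \<bullet> y" for x y
    by (simp add: Jsk JJ)
  show ?thesis
  proof (rule that[of J])
    show "skew_symmetric J"
      unfolding skew_symmetric_def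
    proof (subst matrix_eq, intro allI, rule vector_eq_rdot[THEN iffD1], rule allI)
      fix x y show "(transpose J *v x) \<bullet> y = ((- J) *v x) \<bullet> y"
        using inner_matrix_vector_mult_left[of "transpose J" x y] Jsk[of x y]
        by (simp add: matrix_vector_mult_minus_left)
    qed
    fix z
    show "(J *v z) \<bullet> (J *v z) = z \<bullet> z" by (rule Jiso)
    show "(B *v z) \<bullet> (J *v z) = z \<bullet> (S *v z)"
      using Jiso[of "S *v z" z] by (simp add: JS SJ Ssym)
    show "(S *v z) \<bullet> (J *v z) = 0"
      using Bsk[of z z] by (simp add: Ssym SJ inner_commute[of z])
  qed
qed

subsection \<open>Integration of directional derivatives and powers\<close>

lemma integral_lborel_translation:
  fixes f :: "'a::euclidean_space \<Rightarrow> real"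
  assumes [measurable]: "f \<in> borel_measurable borel"
  shows "(\<integral>x. f (x + c) \<partial>lborel) = (\<integral>x. f x \<partial>lborel)"
proof -
  have "(\<integral>x. f x \<partial>lborel) = (\<integral>x. f x \<partial>distr lborel borel ((+) c))"
    by (simp add: lborel_distr_plus)
  also have "\<dots> = (\<integral>x. f (c + x) \<partial>lborel)"
    by (subst integral_distr) auto
  finally show ?thesis by (simp add: add.commute)
qed

lemma integrable_translation_lborel:
  fixes f :: "'a::euclidean_space \<Rightarrow> real"
  assumes "integrable lborel f"
  shows "integrable lborel (\<lambda>x. f (x + c))"
proof -
  have "integrable (distr lborel borel ((+) c)) f"
    using assms by (simp add: lborel_distr_plus)
  then have "integrable lborel (\<lambda>x. f (c + x))"
    by (subst (asm) integrable_distr_eq) (use assms in auto)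
  then show ?thesis by (simp add: add.commute)
qed

lemma integrable_continuous_compact_support:
  fixes f :: "'a::euclidean_space \<Rightarrow> real"
  assumes "continuous_on UNIV f" "compact K" "\<And>x. x \<notin> K \<Longrightarrow> f x = 0"
  shows "integrable lborel f"
proof -
  have "(\<lambda>x. indicator K x *\<^sub>R f x) = f"
    using assms(3) by (auto simp: indicator_def fun_eq_iff)
  then show ?thesis
    using borel_integrable_compact[OF assms(2) continuous_on_subset[OF assms(1)]] by fastforce
qed

text \<open>Difference quotients have integral zero by translation invariance; dominated convergence
  passes to the limit, so no iterated integration is needed.\<close>

lemma integral_directional_derivative_eq_0:
  fixes h :: "'a::euclidean_space \<Rightarrow> real"
  assumes der: "\<And>x. (h has_derivative D x) (at x)"
    and cont: "continuous_on UNIV (\<lambda>x. D x v)"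
    and K: "compact K" "\<And>x. x \<notin> K \<Longrightarrow> h x = 0"
  shows "integrable lborel (\<lambda>x. D x v)" "(\<integral>x. D x v \<partial>lborel) = 0"
proof -
  have hcont: "continuous_on UNIV h"
    using der has_derivative_continuous by (blast intro: continuous_at_imp_continuous_on)
  have hint: "integrable lborel h"
    by (rule integrable_continuous_compact_support[OF hcont K])
  have [measurable]: "h \<in> borel_measurable borel" "(\<lambda>x. D x v) \<in> borel_measurable borel"
    using hcont cont by (auto intro: borel_measurable_continuous_onI)
  have D0: "D x v = 0" if "x \<notin> K" for x
  proof -
    have "open (- K)" using K(1) compact_imp_closed by auto
    have "((\<lambda>x. 0) has_derivative D x) (at x)"
      by (rule has_derivative_transform_within_open[OF der \<open>open (- K)\<close>]) (use that K(2) in auto)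
    then have "D x = (\<lambda>_. 0)"
      by (rule has_derivative_unique) (rule has_derivative_const)
    then show ?thesis by simp
  qed
  show "integrable lborel (\<lambda>x. D x v)"
    by (rule integrable_continuous_compact_support[OF cont K(1) D0])
  obtain C where C: "\<And>x. \<bar>D x v\<bar> \<le> C" "C \<ge> 0"
  proof -
    have "bounded ((\<lambda>x. D x v) ` K)"
      by (intro compact_imp_bounded compact_continuous_image continuous_on_subset[OF cont] K) auto
    then obtain C where C: "\<forall>x\<in>K. \<bar>D x v\<bar> \<le> C"
      by (auto simp: bounded_iff)
    have "\<bar>D x v\<bar> \<le> max C 0" for x
      using C D0[of x] by (cases "x \<in> K") (auto intro: order_trans)
    then show ?thesis using that[of "max C 0"] by auto
  qed
  \<comment> \<open>\<open>K\<close> swept backwards along \<open>v\<close> for times in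
    \<open>[0, 1]\<close>, so that it contains the support of every difference quotient with step
    \<open>e n \<le> 1\<close>.\<close>
  define K' where "K' = (\<lambda>(y, s). y - s *\<^sub>R v) ` (K \<times> {0..1::real})"
  have "compact K'"
    unfolding K'_def case_prod_unfold
    by (intro compact_continuous_image continuous_intros compact_Times K compact_Icc)
  have K': "h (x + s *\<^sub>R v) = 0" if "x \<notin> K'" "0 \<le> s" "s \<le> 1" for x s
  proof (rule K(2), rule notI)
    assume "x + s *\<^sub>R v \<in> K"
    then have "(\<lambda>(y, s). y - s *\<^sub>R v) (x + s *\<^sub>R v, s) \<in> K'"
      unfolding K'_def using that by (intro imageI) auto
    then show False using that by simp
  qed
  define e :: "nat \<Rightarrow> real" where "e n = inverse (real (Suc n))" for n
  have e: "0 < e n" "e n \<le> 1" for n by (auto simp: e_def field_simps)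
  define q where "q n x = (h (x + e n *\<^sub>R v) - h x) / e n" for n x
  have line: "((\<lambda>s. h (x + s *\<^sub>R v)) has_real_derivative D (x + s *\<^sub>R v) v) (at s)" for x s
  proof -
    have "((\<lambda>s. x + s *\<^sub>R v) has_derivative (\<lambda>t. t *\<^sub>R v)) (at s)"
      by (auto intro!: derivative_eq_intros)
    from has_derivative_compose[OF this der]
    have "((\<lambda>s. h (x + s *\<^sub>R v)) has_derivative (\<lambda>t. D (x + s *\<^sub>R v) (t *\<^sub>R v))) (at s)" .
    moreover have "D (x + s *\<^sub>R v) (t *\<^sub>R v) = D (x + s *\<^sub>R v) v * t" for t
      using linear_scale[OF has_derivative_linear[OF der]] by simp
    ultimately show ?thesis by (simp add: has_field_derivative_def)
  qed
  have "(\<lambda>n. \<integral>x. q n x \<partial>lborel) \<longlonglongrightarrow> (\<integral>x. D x v \<partial>lborel)"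
  proof (rule integral_dominated_convergence[where w = "\<lambda>x. C * indicator K' x"])
    show "(\<lambda>x. D x v) \<in> borel_measurable lborel" by simp
    show "q n \<in> borel_measurable lborel" for n unfolding q_def by measurable
    show "integrable lborel (\<lambda>x. C * indicator K' x)"
      using borel_integrable_compact[OF \<open>compact K'\<close> continuous_on_const[of K' C]]
      by (simp add: mult.commute)
    show "AE x in lborel. (\<lambda>n. q n x) \<longlonglongrightarrow> D x v"
    proof (rule AE_I2)
      fix x
      have "((\<lambda>s. (h (x + s *\<^sub>R v) - h x) / s) \<longlongrightarrow> D x v) (at 0)"
        using line[of x 0] by (simp add: DERIV_def)
      moreover have "filterlim e (at 0) sequentially"
        unfolding e_def filterlim_at
        using LIMSEQ_inverse_real_of_nat by (auto simp: eventually_sequentially)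
      ultimately show "(\<lambda>n. q n x) \<longlonglongrightarrow> D x v"
        unfolding q_def by (rule filterlim_compose)
    qed
    show "AE x in lborel. norm (q n x) \<le> C * indicator K' x" for n
    proof (rule AE_I2)
      fix x
      show "norm (q n x) \<le> C * indicator K' x"
      proof (cases "x \<in> K'")
        case True
        \<comment> \<open>The mean value theorem along the line turns the bound \<open>C\<close> on
          the derivative into a bound on the quotient.\<close>
        obtain s where "h (x + e n *\<^sub>R v) - h (x + 0 *\<^sub>R v) = (e n - 0) * D (x + s *\<^sub>R v) v"
          using MVT2[of 0 "e n" "\<lambda>s. h (x + s *\<^sub>R v)", OF e(1) line] by blast
        then have "q n x = D (x + s *\<^sub>R v) v" using e[of n] by (simp add: q_def)
        then show ?thesis using C True by simp
      next
        case False
        then show ?thesis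
          using K'[of x 0] K'[of x "e n"] e[of n] by (simp add: q_def)
      qed
    qed
  qed
  moreover have "(\<integral>x. q n x \<partial>lborel) = 0" for n
    unfolding q_def
    by (simp add: hint integrable_translation_lborel[OF hint] integral_lborel_translation)
  ultimately show "(\<integral>x. D x v \<partial>lborel) = 0"
    by (simp add: LIMSEQ_const_iff)
qed

section \<open>Powers of the absolute value and Young's inequality\<close>

text \<open>Away from \<open>0\<close> this is the chain rule. At \<open>0\<close> the quotient is
  bounded by \<open>\<bar>h\<bar> powr (p - 1)\<close>, which tends to \<open>0\<close> because
  \<open>p > 1\<close>.\<close>

lemma has_real_derivative_abs_powr:
  fixes p y :: real
  assumes "p > 1"
  shows "((\<lambda>y. \<bar>y\<bar> powr p) has_real_derivative p * \<bar>y\<bar> powr (p - 1) * sgn y) (at y)"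
proof (cases "y = 0")
  case False
  have "((\<lambda>y. \<bar>y\<bar>) has_real_derivative sgn y) (at y)"
  proof -
    have "(norm has_derivative (\<lambda>h. sgn y * h)) (at y)"
      by (rule has_derivative_eq_rhs[OF has_derivative_norm[OF False]])
        (simp add: fun_eq_iff real_sgn_eq)
    moreover have "norm = (abs :: real \<Rightarrow> real)" by (simp add: fun_eq_iff)
    ultimately show ?thesis unfolding has_field_derivative_def by simp
  qed
  from DERIV_fun_powr[OF this, of p] False show ?thesis by simp
next
  case True
  have "((\<lambda>h. \<bar>h\<bar> powr p / h) \<longlongrightarrow> 0) (at (0::real))"
  proof (rule Lim_null_comparison)
    show "\<forall>\<^sub>F h in at 0. norm (\<bar>h\<bar> powr p / h) \<le> \<bar>h\<bar> powr (p - 1)"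
      by (auto simp: eventually_at_filter powr_diff)
    have "((\<lambda>h. \<bar>h\<bar> powr (p - 1)) \<longlongrightarrow> \<bar>0\<bar> powr (p - 1)) (at (0::real))"
      using assms by (intro tendsto_powr' tendsto_intros) auto
    then show "((\<lambda>h. \<bar>h\<bar> powr (p - 1)) \<longlongrightarrow> 0) (at (0::real))" by simp
  qed
  then show ?thesis using True assms by (simp add: DERIV_def)
qed

text \<open>The jump of \<open>sgn\<close> at \<open>0\<close> is damped by the vanishing power.
  With \<open>a = p - 1\<close> this covers the derivative of \<open>\<bar>y\<bar> powr p\<close>,
  up to the factor \<open>p\<close>.\<close>

lemma continuous_on_abs_powr_sgn:
  assumes "a > 0"
  shows "continuous_on UNIV (\<lambda>y::real. \<bar>y\<bar> powr a * sgn y)"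
proof (rule continuous_at_imp_continuous_on, rule ballI)
  fix y :: real
  show "isCont (\<lambda>y. \<bar>y\<bar> powr a * sgn y) y"
  proof (cases "y = 0")
    case True
    have "((\<lambda>y. \<bar>y\<bar> powr a * sgn y) \<longlongrightarrow> 0) (at (0::real))"
    proof (rule Lim_null_comparison)
      show "\<forall>\<^sub>F h in at 0. norm (\<bar>h\<bar> powr a * sgn h) \<le> \<bar>h::real\<bar> powr a"
        by (auto simp: abs_mult sgn_if)
      have "((\<lambda>h. \<bar>h\<bar> powr a) \<longlongrightarrow> \<bar>0\<bar> powr a) (at (0::real))"
        using assms by (intro tendsto_powr' tendsto_intros) auto
      then show "((\<lambda>h. \<bar>h\<bar> powr a) \<longlongrightarrow> 0) (at (0::real))" using assms by simp
    qed
    then show ?thesis using True by (simp add: isCont_def)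
  qed (auto intro!: continuous_intros)
qed

text \<open>This is the tangent line inequality for the convex function \<open>x powr p\<close> at
  the point \<open>k * Y\<close>, obtained from Young's inequality. The weight \<open>k\<close> is
  left free so that it can be matched to the divergence later.\<close>

lemma powr_tangent_bound:
  fixes X Y k p :: real
  assumes p: "p > 1" and nn: "X \<ge> 0" "Y \<ge> 0" and k: "k > 0"
  shows "X powr p - k powr p * Y powr p
    \<ge> p * k powr (p - 1) * (X * Y powr (p - 1) - k * Y powr p)"
proof -
  define q where "q = p / (p - 1)"
  define w where "w = k * Y"
  have w: "w \<ge> 0" using nn k by (simp add: w_def)
  have q: "q > 1" "1 / p + 1 / q = 1" using p by (auto simp: q_def field_simps)
  have "X * w powr (p - 1) \<le> X powr p / p + (w powr (p - 1)) powr q / q"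
    by (rule Youngs_inequality) (use p q nn in auto)
  also have "(w powr (p - 1)) powr q = w powr p"
    using p by (simp add: powr_powr q_def)
  finally have "p * (X * w powr (p - 1)) \<le> X powr p + (p - 1) * w powr p"
    using p by (simp add: q_def field_simps)
  moreover have "w powr p = k powr p * Y powr p" "w powr (p - 1) = k powr (p - 1) * Y powr (p - 1)"
    using nn k by (auto simp: w_def powr_mult)
  moreover have "k powr p = k powr (p - 1) * k"
    using k powr_mult_base[of k "p - 1"] by (simp add: mult.commute)
  ultimately show ?thesis by (simp add: algebra_simps)
qed

subsection \<open>The horizontal vector field\<close>

text \<open>The open sets \<open>- {a}\<close> and \<open>- K\<close> cover the space. It is used
  with \<open>a\<close> the origin, where the vector field is singular, and \<open>K\<close> the
  support of a test function.\<close>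

lemma continuous_on_UNIV_zero_off_closed:
  fixes f :: "'a::t1_space \<Rightarrow> 'b::{topological_space, zero}"
  assumes "continuous_on (- {a}) f" "closed K" "a \<notin> K" "\<And>x. x \<notin> K \<Longrightarrow> f x = 0"
  shows "continuous_on UNIV f"
proof -
  have "continuous_on (- K) f"
    by (rule continuous_on_eq[OF continuous_on_const[of _ 0]]) (use assms(4) in auto)
  then have "continuous_on (- {a} \<union> - K) f"
    using assms by (intro continuous_on_open_Un) auto
  moreover have "- {a} \<union> - K = UNIV" using assms(3) by auto
  ultimately show ?thesis by simp
qed

text \<open>The coefficient \<open>(1/2) * (B *v fst x) $ i\<close> of the vertical derivative does
  not depend on the last coordinate, so it can be moved under that derivative. Every summand is then
  a derivative in a fixed direction of a compactly supported function.\<close>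

lemma horizontal_divergence_integral_eq_0:
  fixes B :: "real^'m^'m" and V :: "(real^'m) \<times> real \<Rightarrow> real^'m"
  assumes der: "\<And>x. (V has_derivative V' x) (at x)"
    and cont: "\<And>v. continuous_on UNIV (\<lambda>x. V' x v)"
    and K: "compact K" "\<And>x. x \<notin> K \<Longrightarrow> V x = 0"
  defines "D \<equiv> \<lambda>x. \<Sum>i\<in>UNIV. V' x (axis i 1, (1/2) * (B *v fst x) $ i) $ i"
  shows "integrable lborel D" "(\<integral>x. D x \<partial>lborel) = 0"
proof -
  have lin: "linear (V' x)" for x using der by (rule has_derivative_linear)
  have derV: "((\<lambda>x. V x $ i) has_derivative (\<lambda>v. V' x v $ i)) (at x)" for x i
    by (rule bounded_linear.has_derivative[OF bounded_linear_vec_nth der])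
  have contV: "continuous_on UNIV V"
    using der has_derivative_continuous by (blast intro: continuous_at_imp_continuous_on)
  have derB: "((\<lambda>x. (1/2) * (B *v fst x) $ i) has_derivative (\<lambda>v. (1/2) * (B *v fst v) $ i)) (at x)"
    for x :: "(real^'m) \<times> real" and i
    by (intro bounded_linear_imp_has_derivative linear_conv_bounded_linear[THEN iffD1] linearI)
      (simp_all add: matrix_vector_right_distrib matrix_vector_mult_scaleR algebra_simps)
  \<comment> \<open>At \<open>v = (0, 1)\<close> the second summand vanishes because
    \<open>fst v = 0\<close>, which leaves exactly the vertical part of the divergence.\<close>
  let ?W' = "\<lambda>i x v. (1/2) * (B *v fst x) $ i * V' x v $ i + (1/2) * (B *v fst v) $ i * V x $ i"
  have derW: "((\<lambda>x. (1/2) * (B *v fst x) $ i * V x $ i) has_derivative ?W' i x) (at x)" for i x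
    by (rule has_derivative_mult[OF derB derV])
  have contB: "continuous_on UNIV (\<lambda>x::(real^'m) \<times> real. (1/2) * (B *v fst x) $ i)" for i
    using derB has_derivative_continuous by (blast intro: continuous_at_imp_continuous_on)
  have 1: "integrable lborel (\<lambda>x. V' x (axis i 1, 0) $ i)"
    "(\<integral>x. V' x (axis i 1, 0) $ i \<partial>lborel) = 0" for i
    by (rule integral_directional_derivative_eq_0[OF derV continuous_on_component[OF cont] K(1)],
        simp add: K(2))+
  have contW: "continuous_on UNIV (\<lambda>x. ?W' i x (0, 1))" for i
    by (intro continuous_on_add continuous_on_mult contB continuous_on_component cont contV
        continuous_on_const)
  have 2: "integrable lborel (\<lambda>x. ?W' i x (0, 1))" "(\<integral>x. ?W' i x (0, 1) \<partial>lborel) = 0" for i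
    by (rule integral_directional_derivative_eq_0[OF derW contW K(1)], simp add: K(2))+
  have D: "D = (\<lambda>x. \<Sum>i\<in>UNIV. V' x (axis i 1, 0) $ i + ?W' i x (0, 1))"
  proof
    fix x
    have "V' x (axis i 1, c) = V' x (axis i 1, 0) + c *\<^sub>R V' x (0, 1)" for i c
    proof -
      have "V' x (axis i 1, c) = V' x ((axis i 1, 0) + c *\<^sub>R (0, 1))" by simp
      also have "\<dots> = V' x (axis i 1, 0) + c *\<^sub>R V' x (0, 1)"
        by (simp only: linear_add[OF lin] linear_scale[OF lin])
      finally show ?thesis .
    qed
    note split = this
    show "D x = (\<Sum>i\<in>UNIV. V' x (axis i 1, 0) $ i + ?W' i x (0, 1))"
      unfolding D_def
    proof (intro sum.cong refl)
      fix i
      show "V' x (axis i 1, (1/2) * (B *v fst x) $ i) $ i = V' x (axis i 1, 0) $ i + ?W' i x (0, 1)"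
        by (subst split) (simp add: matrix_vector_mult_0_right)
    qed
  qed
  show "integrable lborel D"
    unfolding D by (intro Bochner_Integration.integrable_sum Bochner_Integration.integrable_add 1 2)
  show "(\<integral>x. D x \<partial>lborel) = 0"
    unfolding D using 1 2
    by (subst Bochner_Integration.integral_sum) (auto intro!: Bochner_Integration.integrable_add)
qed

text \<open>Nonnegativity of the quadratic form turns the fourth power of its square root into a
  square, so the gauge becomes a power of a polynomial.\<close>

lemma rhoB_eq:
  fixes B :: "real^'m^'m"
  assumes "\<And>z. z \<bullet> (matrix_sqrt (- (B ** B)) *v z) \<ge> 0"
  shows "rhoB B x = ((fst x \<bullet> (matrix_sqrt (- (B ** B)) *v fst x) / 4)^2 + (snd x)^2) powr (1/4)"
proof -
  have "sqrt a ^ 4 = a^2" if "a \<ge> 0" for a :: real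
    using that power_mult[of "sqrt a" 2 2] by simp
  then show ?thesis
    using assms[of "fst x"] by (simp add: rhoB_def normB_def power_mult_distrib power_divide)
qed

lemma continuous_on_matrix_fst:
  fixes M :: "real^'m^'m"
  shows "continuous_on A (\<lambda>x::(real^'m) \<times> real. M *v fst x)"
  by (intro linear_continuous_on_compose[OF _ matrix_vector_mul_linear] continuous_intros)

text \<open>Contracts a differential, evaluated on the horizontal frame, with a vector. In the
  divergence \<open>y\<close> and \<open>w\<close> are the images of the horizontal position under
  \<open>S\<close> and \<open>B\<close>, and \<open>z\<close> is that position or its image under
  \<open>J\<close>.\<close>

lemma sum_horizontal:
  "(\<Sum>i\<in>UNIV. (a * (y \<bullet> axis i 1) + c * ((1/2) * w $ i)) * z $ i) = a * (y \<bullet> z) + c / 2 * (w \<bullet> z)"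
  for y w z :: "real^'m"
  by (simp add: inner_axis inner_vec_def[of y z] inner_vec_def[of w z] sum_distrib_left
      sum.distrib algebra_simps)

lemma smooth_fun_derivative:
  assumes "smooth_fun u"
  shows "(u has_derivative frechet_derivative u (at x)) (at x)"
    "continuous_on UNIV (\<lambda>x. frechet_derivative u (at x) v)"
proof -
  have diff: "iter_deriv u vs differentiable (at x)" for vs x
    using assms by (simp add: smooth_fun_def)
  show "(u has_derivative frechet_derivative u (at x)) (at x)"
    using diff[of "[]"] frechet_derivative_works by auto
  show "continuous_on UNIV (\<lambda>x. frechet_derivative u (at x) v)"
    using differentiable_imp_continuous_within[OF diff[of "[v]"]]
    by (auto intro!: continuous_at_imp_continuous_on)
qed

text \<open>The intended instance is \<open>S = (-B\<^sup>2)\<^sup>1\<^sup>/\<^sup>2\<close>, \<open>J = S\<^sup>-\<^sup>1 B\<close>, \<open>b = p\<theta>\<close> and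
  \<open>s = b / (Q - b)\<close>, with \<open>l\<close> the least eigenvalue of \<open>S\<close>. Then \<open>r = |z|\<^sub>B\<^sup>2\<close>, \<open>P = \<rho>\<^sub>B\<^sup>4\<close>, and
  \<open>fz\<close>, \<open>ft\<close>, \<open>gz\<close>, \<open>gt\<close> are the coefficients of \<open>\<langle>Sz, \<zeta>\<rangle>\<close> and \<open>\<tau>\<close> in the differentials of
  \<open>f\<close> and \<open>g\<close> at \<open>(z, t)\<close> in direction \<open>(\<zeta>, \<tau>)\<close>.\<close>

locale hardy_structure =
  fixes B S J :: "real^'m^'m" and l b s :: real
  assumes skewB: "skew_symmetric B" and skewJ: "skew_symmetric J"
    and symS: "transpose S = S"
    and J_iso: "\<And>z. (J *v z) \<bullet> (J *v z) = z \<bullet> z"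
    and BJ: "\<And>z. (B *v z) \<bullet> (J *v z) = z \<bullet> (S *v z)"
    and SJ: "\<And>z. (S *v z) \<bullet> (J *v z) = 0"
    and l_pos: "l > 0" and l_le: "\<And>z. l * (z \<bullet> z) \<le> z \<bullet> (S *v z)"
    and s_eq: "s * (real CARD('m) + 2 - b) = b"
begin

definition r :: "(real^'m) \<times> real \<Rightarrow> real" where
  "r x = (fst x \<bullet> (S *v fst x)) / 4"

definition P :: "(real^'m) \<times> real \<Rightarrow> real" where
  "P x = (r x)^2 + (snd x)^2"

definition f :: "(real^'m) \<times> real \<Rightarrow> real" where
  "f x = P x powr (- b/4) + s * P x powr (- b/4 - 1) * (r x)^2"

definition g :: "(real^'m) \<times> real \<Rightarrow> real" where
  "g x = s * P x powr (- b/4 - 1) * r x * snd x"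

definition F :: "(real^'m) \<times> real \<Rightarrow> real^'m" where
  "F x = f x *\<^sub>R fst x + g x *\<^sub>R (J *v fst x)"

definition fz :: "(real^'m) \<times> real \<Rightarrow> real" where
  "fz x = - (b/4) * P x powr (- b/4 - 1) * r x
    + s * (- (b/4 + 1) * P x powr (- b/4 - 2) * (r x)^3 + P x powr (- b/4 - 1) * r x)"

definition ft :: "(real^'m) \<times> real \<Rightarrow> real" where
  "ft x = - (b/2) * P x powr (- b/4 - 1) * snd x
    - s * (b/2 + 2) * P x powr (- b/4 - 2) * snd x * (r x)^2"

definition gz :: "(real^'m) \<times> real \<Rightarrow> real" where
  "gz x = s * (- (b/4 + 1) * P x powr (- b/4 - 2) * (r x)^2 * snd x
    + P x powr (- b/4 - 1) * snd x / 2)"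

definition gt :: "(real^'m) \<times> real \<Rightarrow> real" where
  "gt x = s * (- (b/2 + 2) * P x powr (- b/4 - 2) * (snd x)^2 * r x
    + P x powr (- b/4 - 1) * r x)"

definition F' :: "(real^'m) \<times> real \<Rightarrow> (real^'m) \<times> real \<Rightarrow> real^'m" where
  "F' x v = f x *\<^sub>R fst v + (fz x * ((S *v fst x) \<bullet> fst v) + ft x * snd v) *\<^sub>R fst x
    + (g x *\<^sub>R (J *v fst v) + (gz x * ((S *v fst x) \<bullet> fst v) + gt x * snd v) *\<^sub>R (J *v fst x))"

lemma r_ge: "r x \<ge> l / 4 * (fst x \<bullet> fst x)"
  using l_le[of "fst x"] by (simp add: r_def)

lemma r_nonneg: "r x \<ge> 0"
  using r_ge[of x] l_pos inner_ge_zero[of "fst x"]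
  by (meson divide_nonneg_pos less_imp_le mult_nonneg_nonneg order_trans zero_less_numeral)

lemma P_pos: "P x > 0" if "x \<noteq> 0"
proof (cases "fst x = 0")
  case True
  then have "snd x \<noteq> 0" using that by (simp add: prod_eq_iff)
  then show ?thesis by (simp add: P_def pos_add_strict add_nonneg_pos)
next
  case False
  then have "r x > 0"
    using r_ge[of x] l_pos by (smt (verit) divide_pos_pos inner_gt_zero_iff mult_pos_pos)
  then show ?thesis by (simp add: P_def add_pos_nonneg)
qed

lemma has_derivative_r: "(r has_derivative (\<lambda>v. ((S *v fst x) \<bullet> fst v) / 2)) (at x)"
proof -
  have S: "((\<lambda>x. S *v fst x) has_derivative (\<lambda>v. S *v fst v)) (at x)"
    for x :: "(real^'m) \<times> real"
    by (intro bounded_linear_imp_has_derivative linear_conv_bounded_linear[THEN iffD1] linearI)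
      (simp_all add: matrix_vector_right_distrib matrix_vector_mult_scaleR)
  have "(S *v fst x) \<bullet> y = fst x \<bullet> (S *v y)" for y
    using inner_matrix_vector_mult_left[of S "fst x" y] symS by simp
  then have "fst x \<bullet> (S *v fst v) + fst v \<bullet> (S *v fst x) = 2 * ((S *v fst x) \<bullet> fst v)" for v
    by (simp add: inner_commute)
  then show ?thesis
    unfolding r_def[abs_def]
    by (auto intro!: derivative_eq_intros S simp: fun_eq_iff)
qed

lemma has_derivative_P:
  "(P has_derivative (\<lambda>v. r x * ((S *v fst x) \<bullet> fst v) + 2 * snd x * snd v)) (at x)"
  unfolding P_def[abs_def]
  by (auto intro!: derivative_eq_intros has_derivative_r simp: fun_eq_iff)

lemma has_derivative_P_powr:
  assumes "x \<noteq> 0"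
  shows "((\<lambda>x. P x powr a) has_derivative
    (\<lambda>v. a * P x powr (a - 1) * (r x * ((S *v fst x) \<bullet> fst v) + 2 * snd x * snd v))) (at x)"
proof -
  have "((\<lambda>y. y powr a) has_derivative (\<lambda>h. a * P x powr (a - 1) * h)) (at (P x))"
    using has_real_derivative_powr[OF P_pos[OF assms], of a]
    by (simp add: has_field_derivative_def)
  from has_derivative_compose[OF has_derivative_P this] show ?thesis .
qed

lemma has_derivative_f:
  assumes "x \<noteq> 0"
  shows "(f has_derivative (\<lambda>v. fz x * ((S *v fst x) \<bullet> fst v) + ft x * snd v)) (at x)"
  unfolding f_def[abs_def]
  by (rule has_derivative_eq_rhs)
    (rule derivative_intros has_derivative_P_powr has_derivative_r assms
      | auto simp: fun_eq_iff fz_def ft_def algebra_simps power2_eq_square power3_eq_cube)+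

lemma has_derivative_g:
  assumes "x \<noteq> 0"
  shows "(g has_derivative (\<lambda>v. gz x * ((S *v fst x) \<bullet> fst v) + gt x * snd v)) (at x)"
  unfolding g_def[abs_def]
  by (rule has_derivative_eq_rhs)
    (rule derivative_intros has_derivative_P_powr has_derivative_r assms
      | auto simp: fun_eq_iff gz_def gt_def algebra_simps power2_eq_square power3_eq_cube)+

lemma has_derivative_F:
  assumes "x \<noteq> 0"
  shows "(F has_derivative F' x) (at x)"
proof -
  have J: "((\<lambda>x. J *v fst x) has_derivative (\<lambda>v. J *v fst v)) (at x)"
    by (intro bounded_linear_imp_has_derivative linear_conv_bounded_linear[THEN iffD1] linearI)
      (simp_all add: matrix_vector_right_distrib matrix_vector_mult_scaleR)
  show ?thesis
    unfolding F_def[abs_def] F'_def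
    by (intro has_derivative_add has_derivative_scaleR has_derivative_f has_derivative_g
        has_derivative_fst has_derivative_ident J assms)
qed

lemma continuous_on_r: "continuous_on A r"
  using has_derivative_r has_derivative_continuous
  by (blast intro: continuous_at_imp_continuous_on)

lemma continuous_on_P: "continuous_on A P"
  using has_derivative_P has_derivative_continuous
  by (blast intro: continuous_at_imp_continuous_on)

lemma continuous_on_P_powr: "continuous_on (- {0}) (\<lambda>x. P x powr a)"
  by (intro continuous_on_powr continuous_on_P continuous_on_const) (use P_pos in force)

lemmas continuous_on_polynomial_rules =
  continuous_on_P_powr continuous_on_r continuous_on_matrix_fst continuous_on_const
  continuous_on_fst continuous_on_snd continuous_on_id continuous_on_add continuous_on_diff
  continuous_on_mult continuous_on_scaleR continuous_on_inner continuous_on_power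
  continuous_on_minus

lemma continuous_on_coefficients:
  "continuous_on (- {0}) f" "continuous_on (- {0}) g"
  "continuous_on (- {0}) fz" "continuous_on (- {0}) ft"
  "continuous_on (- {0}) gz" "continuous_on (- {0}) gt"
  \<comment> \<open>Unfolding \<open>divide_inverse\<close> turns division by a numeral into
    multiplication by a constant, which the listed rules handle.\<close>
  unfolding f_def[abs_def] g_def[abs_def] fz_def[abs_def] ft_def[abs_def] gz_def[abs_def]
    gt_def[abs_def] divide_inverse
  by (rule continuous_on_polynomial_rules)+

lemma continuous_on_F: "continuous_on (- {0}) F"
  unfolding F_def[abs_def]
  by (rule continuous_on_coefficients continuous_on_polynomial_rules)+

lemma continuous_on_F': "continuous_on (- {0}) (\<lambda>x. F' x v)"
  unfolding F'_def
  by (rule continuous_on_coefficients continuous_on_polynomial_rules)+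

text \<open>The value of \<open>s\<close> is the one for which the \<open>r\<^sup>2\<close>-terms of the divergence cancel.\<close>

lemma horizontal_divergence_F:
  assumes "x \<noteq> 0"
  shows "(\<Sum>i\<in>UNIV. F' x (axis i 1, (1/2) * (B *v fst x) $ i) $ i)
    = real CARD('m) * P x powr (- b/4)"
proof -
  let ?z = "fst x"
  have Bz: "(B *v ?z) \<bullet> ?z = 0"
    using inner_skew_symmetric[OF skewB, of ?z ?z] by (simp add: inner_commute)
  \<comment> \<open>A skew matrix has zero diagonal, so differentiating the factor
    \<open>J *v fst x\<close> contributes nothing to the divergence.\<close>
  have Jii: "(J *v axis i 1) $ i = 0" for i
    using inner_skew_symmetric[OF skewJ, of "axis i 1" "axis i 1"]
    by (simp add: inner_axis inner_axis')
  have Sz: "(S *v ?z) \<bullet> ?z = 4 * r x" by (simp add: r_def inner_commute)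
  have BJz: "(B *v ?z) \<bullet> (J *v ?z) = 4 * r x" by (simp add: r_def BJ)
  \<comment> \<open>The lowest power of \<open>P x\<close> that occurs. Writing the others as its
    multiples by \<open>P x\<close> and \<open>(P x)^2\<close> leaves a polynomial identity.\<close>
  let ?E = "P x powr (- b/4 - 2)"
  have C: "P x powr (- b/4 - 1) = P x * ?E"
      proof -
    have "1 + (- b/4 - 2) = - b/4 - 1" by simp
    then show ?thesis using P_pos[OF assms] powr_mult_base[of "P x" "- b/4 - 2"] by (simp only: less_imp_le)
  qed
  have A: "P x powr (- b/4) = P x * (P x * ?E)"
    unfolding C[symmetric]
    using P_pos[OF assms] powr_mult_base[of "P x" "- b/4 - 1"] by simp
  have "(\<Sum>i\<in>UNIV. F' x (axis i 1, (1/2) * (B *v ?z) $ i) $ i)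
    = (\<Sum>i\<in>(UNIV::'m set). f x)
      + (\<Sum>i\<in>UNIV. (fz x * ((S *v ?z) \<bullet> axis i 1) + ft x * ((1/2) * (B *v ?z) $ i)) * ?z $ i)
      + (\<Sum>i\<in>UNIV. (gz x * ((S *v ?z) \<bullet> axis i 1) + gt x * ((1/2) * (B *v ?z) $ i)) * (J *v ?z) $ i)"
    by (simp add: F'_def Jii sum.distrib)
  \<comment> \<open>Orthogonality removes the \<open>ft\<close> and \<open>gz\<close> terms; the two
    remaining pairings both equal \<open>4 * r x\<close>.\<close>
  also have "\<dots> = real CARD('m) * f x + 4 * r x * fz x + 2 * r x * gt x"
    unfolding sum_horizontal by (simp add: Sz Bz SJ BJz)
  also have "\<dots> = real CARD('m) * P x powr (- b/4)
      + P x powr (- b/4 - 1) * (r x)^2 * (s * (real CARD('m) + 2 - b) - b)"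
  proof -
    have ring: "m * (Q * (Q * E) + s * (Q * E) * r^2)
        + 4 * r * (- (b/4) * (Q * E) * r + s * (- (b/4 + 1) * E * r^3 + Q * E * r))
        + 2 * r * (s * (- (b/2 + 2) * E * t^2 * r + Q * E * r))
      = m * (Q * (Q * E)) + Q * E * r^2 * (s * (m + 2 - b) - b)"
      if "Q = r^2 + t^2" for m Q E r t :: real
      unfolding that by (simp add: field_simps power2_eq_square power3_eq_cube)
    show ?thesis
      unfolding f_def fz_def gt_def A C by (rule ring) (rule P_def)
  qed
  finally show ?thesis by (simp add: s_eq)
qed

text \<open>The vectors \<open>z\<close> and \<open>J *v z\<close> are orthogonal and of equal
  length, so the squared norm is \<open>f^2 + g^2\<close> times \<open>z \<bullet> z\<close>, and
  \<open>z \<bullet> z\<close> is at most \<open>4 / l * r x\<close>. In the homogeneous variable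
  \<open>y = r x / sqrt (P x)\<close> the estimate becomes the cubic bound \<open>M\<close>.\<close>

lemma norm_F_le:
  assumes M: "\<And>y. 0 \<le> y \<Longrightarrow> y \<le> 1 \<Longrightarrow> y * (1 + (2 * s + s^2) * y^2) \<le> M" and x: "x \<noteq> 0"
  shows "norm (F x) \<le> sqrt (4 * M / l) * P x powr ((1 - b) / 4)"
proof -
  let ?z = "fst x"
  have Pp: "P x > 0" using P_pos[OF x] .
  let ?C = "P x powr (- b/4 - 1)"
  have A: "P x powr (- b/4) = P x * ?C"
    using Pp powr_mult_base[of "P x" "- b/4 - 1"] by simp
  have Jz: "(J *v ?z) \<bullet> ?z = 0"
    using inner_skew_symmetric[OF skewJ, of ?z ?z] by (simp add: inner_commute)
  define y where "y = r x / sqrt (P x)"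
  have ry: "r x = y * sqrt (P x)" using Pp by (simp add: y_def)
  have y: "0 \<le> y" "y \<le> 1"
  proof -
    show "0 \<le> y" using r_nonneg[of x] Pp by (simp add: y_def)
    have "r x \<le> sqrt (P x)" by (rule real_le_rsqrt) (simp add: P_def)
    then show "y \<le> 1" using Pp by (simp add: y_def)
  qed
  have fg: "(f x)^2 + (g x)^2 = ?C^2 * P x * (P x + (2 * s + s^2) * (r x)^2)"
  proof -
    have ring: "(Q * C + s * C * r^2)^2 + (s * C * r * t)^2 = C^2 * Q * (Q + (2 * s + s^2) * r^2)"
      if "Q = r^2 + t^2" for Q C r t :: real
      unfolding that by (simp add: algebra_simps power2_eq_square)
    show ?thesis
      unfolding f_def g_def A by (rule ring) (rule P_def)
  qed
  have "(norm (F x))^2 = ((f x)^2 + (g x)^2) * (?z \<bullet> ?z)"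
    using Jz unfolding power2_norm_eq_inner
    by (simp add: F_def inner_add_left inner_add_right J_iso
        inner_commute algebra_simps power2_eq_square)
  also have "\<dots> \<le> ((f x)^2 + (g x)^2) * (4 / l * r x)"
    using r_ge[of x] l_pos by (intro mult_left_mono) (auto simp: field_simps)
  also have "\<dots> = 4 / l * (?C^2 * (P x)^2 * sqrt (P x)) * (y * (1 + (2 * s + s^2) * y^2))"
  proof -
    have ring: "C^2 * Q * (Q + a * (y * q)^2) * (4 / l * (y * q)) = 4 / l * (C^2 * Q^2 * q) * (y * (1 + a * y^2))"
      if "q^2 = Q" for C Q q a y :: real
      unfolding that[symmetric] by (simp add: algebra_simps add_divide_distrib power2_eq_square)
    show ?thesis
      unfolding fg ry by (rule ring) (use Pp in simp)
  qed
  also have "\<dots> \<le> 4 / l * (?C^2 * (P x)^2 * sqrt (P x)) * M"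
    using l_pos Pp by (intro mult_left_mono M y) auto
  also have "?C^2 * (P x)^2 * sqrt (P x) = (P x powr ((1 - b) / 4))^2"
  proof -
    have "(P x)^2 = P x powr 2" "sqrt (P x) = P x powr (1/2)"
      using Pp by (simp_all add: powr_half_sqrt)
    then have "?C^2 * (P x)^2 * sqrt (P x) = P x powr ((- b/4 - 1) + (- b/4 - 1) + 2 + 1/2)"
      by (simp only: power2_eq_square[of ?C] powr_add)
    also have "(- b/4 - 1) + (- b/4 - 1) + 2 + 1/2 = (1 - b) / 4 + (1 - b) / 4"
      by (simp add: field_simps)
    finally show ?thesis by (simp only: power2_eq_square powr_add)
  qed
  finally have "(norm (F x))^2 \<le> 4 * M / l * (P x powr ((1 - b) / 4))^2"
    by (simp add: mult_ac)
  then have "norm (F x) \<le> sqrt (4 * M / l * (P x powr ((1 - b) / 4))^2)"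
    by (rule real_le_rsqrt)
  also have "\<dots> = sqrt (4 * M / l) * P x powr ((1 - b) / 4)"
    by (simp only: real_sqrt_mult real_sqrt_abs) simp
  finally show ?thesis .
qed

section \<open>The weighted Hardy inequality for a test function\<close>

text \<open>A suitable multiple of the divergence \<open>D\<close> of
  \<open>\<bar>u\<bar> powr p *\<^sub>R F\<close> is added to the gradient integrand. Its integral
  is zero, so a pointwise comparison of integrands is enough.\<close>

lemma hardy_inequality:
  fixes u :: "(real^'m) \<times> real \<Rightarrow> real" and p M :: real
  assumes p: "p > 1" and u: "u \<in> test_funs"
    and M: "M > 0" "\<And>y. 0 \<le> y \<Longrightarrow> y \<le> 1 \<Longrightarrow> y * (1 + (2 * s + s^2) * y^2) \<le> M"
    and d: "\<And>x. d x = P x powr (1/4)"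
  shows "ennreal ((real CARD('m) / (p * sqrt (4 * M / l))) powr p)
      * (\<integral>\<^sup>+ x. ennreal (\<bar>u x\<bar> powr p / d x powr b) \<partial>lborel)
    \<le> (\<integral>\<^sup>+ x. ennreal (norm (horiz_grad B u x) powr p / d x powr (b - p)) \<partial>lborel)"
proof -
  define K where "K = closure {x. u x \<noteq> 0}"
  have smooth: "smooth_fun u" and K: "compact K" "0 \<notin> K"
    using u by (auto simp: test_funs_def K_def)
  have clK: "closed K" by (simp add: K_def)
  have u0: "u x = 0" if "x \<notin> K" for x
    using that closure_subset[of "{x. u x \<noteq> 0}"] unfolding K_def by blast
  define u' where "u' x = frechet_derivative u (at x)" for x
  have du: "(u has_derivative u' x) (at x)" and cu': "continuous_on UNIV (\<lambda>x. u' x v)" for x v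
    using smooth_fun_derivative[OF smooth] by (auto simp: u'_def)
  have cu: "continuous_on UNIV u"
    using du has_derivative_continuous by (blast intro: continuous_at_imp_continuous_on)
  have lin: "linear (u' x)" for x using du by (rule has_derivative_linear)
  have u'0: "u' x v = 0" if "x \<notin> K" for x v
  proof -
    have "((\<lambda>x. 0) has_derivative u' x) (at x)"
      by (rule has_derivative_transform_within_open[OF du, of "- K"]) (use that u0 clK in auto)
    then have "u' x = (\<lambda>_. 0)"
      by (rule has_derivative_unique) (rule has_derivative_const)
    then show ?thesis by simp
  qed
  define G where "G = horiz_grad B u"
  have G: "G x = (\<chi> i. u' x (axis i 1, (1/2) * (B *v fst x) $ i))" for x
    by (simp add: G_def horiz_grad_def horiz_field_def u'_def)
  have G0: "G x = 0" if "x \<notin> K" for x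
    using u'0[OF that] by (simp add: G vec_eq_iff)
  have cG: "continuous_on UNIV G"
  proof -
    \<comment> \<open>The horizontal directions vary with \<open>x\<close>, whereas continuity of
      the derivative is known for fixed directions; linearity separates the two.\<close>
    have "u' x (axis i 1, c) = u' x (axis i 1, 0) + c * u' x (0, 1)" for x i c
    proof -
      have "u' x (axis i 1, c) = u' x ((axis i 1, 0) + c *\<^sub>R (0, 1))" by simp
      also have "\<dots> = u' x (axis i 1, 0) + c * u' x (0, 1)"
        by (simp only: linear_add[OF lin] linear_scale[OF lin] real_scaleR_def)
      finally show ?thesis .
    qed
    then have G_eq: "G = (\<lambda>x. \<chi> i. u' x (axis i 1, 0) + (1/2) * (B *v fst x) $ i * u' x (0, 1))"
      unfolding G fun_eq_iff vec_eq_iff vec_lambda_beta by blast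
    show ?thesis
      unfolding G_eq
      by (intro continuous_on_vec_lambda continuous_on_add continuous_on_mult cu' continuous_on_const
          continuous_on_component continuous_on_matrix_fst)
  qed
  define a where "a y = p * \<bar>y\<bar> powr (p - 1) * sgn y" for y :: real
  have da: "((\<lambda>y. \<bar>y\<bar> powr p) has_real_derivative a y) (at y)" for y
    unfolding a_def by (rule has_real_derivative_abs_powr[OF p])
  have ca: "continuous_on UNIV (\<lambda>x. a (u x))"
  proof -
    have "continuous_on UNIV (\<lambda>x. p * (\<bar>u x\<bar> powr (p - 1) * sgn (u x)))"
      using p by (intro continuous_on_mult continuous_on_const
          continuous_on_compose2[OF continuous_on_abs_powr_sgn cu]) auto
    then show ?thesis by (simp add: a_def mult.assoc)
  qed
  have dup: "((\<lambda>x. \<bar>u x\<bar> powr p) has_derivative (\<lambda>v. a (u x) * u' x v)) (at x)" for x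
    using has_derivative_compose[OF du da[unfolded has_field_derivative_def]] .
  have cup: "continuous_on UNIV (\<lambda>x. \<bar>u x\<bar> powr p)"
    using dup has_derivative_continuous by (blast intro: continuous_at_imp_continuous_on)
  define V where "V x = \<bar>u x\<bar> powr p *\<^sub>R F x" for x
  define V' where "V' x v = \<bar>u x\<bar> powr p *\<^sub>R F' x v + (a (u x) * u' x v) *\<^sub>R F x" for x v
  have V0: "V x = 0" if "x \<notin> K" for x using u0[OF that] by (simp add: V_def)
  have V'0: "V' x v = 0" if "x \<notin> K" for x v using u0[OF that] by (simp add: V'_def a_def)
  have dV: "(V has_derivative V' x) (at x)" for x
  proof (cases "x = 0")
    case False
    show ?thesis
      unfolding V_def[abs_def] V'_def
      by (rule has_derivative_scaleR[OF dup has_derivative_F[OF False]])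
  next
    \<comment> \<open>The support of \<open>u\<close> stays away from the origin, so
      \<open>V\<close> vanishes near it and the singularity of \<open>F\<close> is harmless.\<close>
    case True
    have "V' x = (\<lambda>_. 0)" using V'0 K(2) True by blast
    moreover have "(V has_derivative (\<lambda>_. 0)) (at x)"
      by (rule has_derivative_transform_within_open[OF has_derivative_const[of 0], of "- K"])
        (use True K(2) clK V0 in auto)
    ultimately show ?thesis by simp
  qed
  have cV': "continuous_on UNIV (\<lambda>x. V' x v)" for v
  proof (rule continuous_on_UNIV_zero_off_closed[OF _ clK K(2) V'0])
    show "continuous_on (- {0}) (\<lambda>x. V' x v)"
      unfolding V'_def
      by (intro continuous_on_add continuous_on_scaleR continuous_on_mult continuous_on_F
          continuous_on_F' continuous_on_subset[OF cup] continuous_on_subset[OF ca]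
          continuous_on_subset[OF cu']) auto
  qed
  define D where "D x = (\<Sum>i\<in>UNIV. V' x (axis i 1, (1/2) * (B *v fst x) $ i) $ i)" for x
  have D: "integrable lborel D" "(\<integral>x. D x \<partial>lborel) = 0"
    unfolding D_def[abs_def]
    by (rule horizontal_divergence_integral_eq_0[OF dV cV' K(1)], erule V0)+
  have D_eq: "D x = \<bar>u x\<bar> powr p * (real CARD('m) * P x powr (- b/4)) + a (u x) * (G x \<bullet> F x)"
    if "x \<noteq> 0" for x
    unfolding horizontal_divergence_F[OF that, symmetric] D_def V'_def G inner_vec_def
    by (simp add: sum.distrib sum_distrib_left mult.assoc)
  define c where "c = real CARD('m)"
  define L where "L = sqrt (4 * M / l)"
  \<comment> \<open>Chosen so that \<open>c = p * L * k\<close>: the lower bound for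
    \<open>D\<close> then has the shape of the right-hand side in
    \<open>powr_tangent_bound\<close>.\<close>
  define k where "k = c / (p * L)"
  have pos: "c > 0" "L > 0" "k > 0" using M l_pos p by (auto simp: c_def L_def k_def)
  have ck: "c = p * L * k" using pos p by (simp add: k_def)
  define A1 where "A1 x = norm (G x) powr p / d x powr (b - p)" for x
  define A0 where "A0 x = \<bar>u x\<bar> powr p / d x powr b" for x
  have d_powr: "d x powr e = P x powr (e / 4)" for x e by (simp add: d powr_powr)
  have A1_eq: "A1 x = norm (G x) powr p * P x powr ((p - b) / 4)"
    and A0_eq: "A0 x = \<bar>u x\<bar> powr p * P x powr (- b/4)" if "x \<noteq> 0" for x
  proof -
    have "(p - b) / 4 = - ((b - p) / 4)" by (simp add: field_simps)
    then show "A1 x = norm (G x) powr p * P x powr ((p - b) / 4)"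
      unfolding A1_def d_powr by (simp only: powr_minus_divide) simp
    show "A0 x = \<bar>u x\<bar> powr p * P x powr (- b/4)"
      unfolding A0_def d_powr by (simp add: powr_minus_divide)
  qed
  have A_zero: "A1 x = 0" "A0 x = 0" if "x \<notin> K" for x
    using G0[OF that] u0[OF that] by (simp_all add: A1_def A0_def)
  have A1: "integrable lborel A1" and A0: "integrable lborel A0"
  proof -
    have "continuous_on (- {0}) A1"
    proof (rule continuous_on_eq[of _ "\<lambda>x. norm (G x) powr p * P x powr ((p - b) / 4)"])
      show "continuous_on (- {0}) (\<lambda>x. norm (G x) powr p * P x powr ((p - b) / 4))"
        using p by (intro continuous_on_mult continuous_on_P_powr continuous_on_powr' continuous_on_norm
            continuous_on_subset[OF cG] continuous_on_const) auto
    qed (use A1_eq in auto)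
    then show "integrable lborel A1"
      using continuous_on_UNIV_zero_off_closed[OF _ clK K(2)] K(1) A_zero(1)
        integrable_continuous_compact_support by blast
    have "continuous_on (- {0}) A0"
    proof (rule continuous_on_eq[of _ "\<lambda>x. \<bar>u x\<bar> powr p * P x powr (- b / 4)"])
      show "continuous_on (- {0}) (\<lambda>x. \<bar>u x\<bar> powr p * P x powr (- b / 4))"
        by (intro continuous_on_mult continuous_on_P_powr continuous_on_subset[OF cup]) auto
    qed (use A0_eq in auto)
    then show "integrable lborel A0"
      using continuous_on_UNIV_zero_off_closed[OF _ clK K(2)] K(1) A_zero(2)
        integrable_continuous_compact_support by blast
  qed
  have pointwise: "k powr p * A0 x \<le> A1 x + (k powr (p - 1) / L) * D x" for x
  proof (cases "x = 0")
    case True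
    then have "D x = 0" using K(2) V'0 by (simp add: D_def)
    then show ?thesis using True K(2) A_zero by simp
  next
    case False
    have Pp: "P x > 0" by (rule P_pos[OF False])
    define Y where "Y = \<bar>u x\<bar>"
    \<comment> \<open>Absorbing one power of the gauge into the gradient gives \<open>A1\<close> and
      \<open>A0\<close> the common weight \<open>w\<close>, which then factors out.\<close>
    define X where "X = P x powr (1/4) * norm (G x)"
    define w where "w = P x powr (- b/4)"
    have nn: "X \<ge> 0" "Y \<ge> 0" "w \<ge> 0" by (simp_all add: X_def Y_def w_def)
    have A0': "A0 x = w * Y powr p" using A0_eq[OF False] by (simp add: w_def Y_def)
    have A1': "A1 x = w * X powr p"
    proof -
      have "X powr p = P x powr (p/4) * norm (G x) powr p"
        by (simp add: X_def powr_mult powr_powr)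
      moreover have "w * P x powr (p/4) = P x powr ((p - b) / 4)"
        by (simp add: w_def powr_add[symmetric] diff_divide_distrib)
      ultimately show ?thesis using A1_eq[OF False] by (simp add: mult.assoc[symmetric])
    qed
    have "\<bar>a (u x) * (G x \<bullet> F x)\<bar> \<le> p * Y powr (p - 1) * (norm (G x) * norm (F x))"
      unfolding abs_mult using Cauchy_Schwarz_ineq2[of "G x" "F x"] p
      by (intro mult_mono) (auto simp: a_def Y_def abs_mult sgn_if)
    also have "\<dots> \<le> p * Y powr (p - 1) * (norm (G x) * (L * P x powr ((1 - b) / 4)))"
      using norm_F_le[OF M(2) False] p by (intro mult_left_mono) (auto simp: L_def)
    also have "P x powr ((1 - b) / 4) = P x powr (1/4) * w"
      by (simp add: w_def powr_add[symmetric] diff_divide_distrib)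
    finally have flux: "\<bar>a (u x) * (G x \<bullet> F x)\<bar> \<le> L * w * p * (X * Y powr (p - 1))"
      by (simp add: X_def mult_ac)
    have "D x \<ge> L * w * p * (k * Y powr p) - L * w * p * (X * Y powr (p - 1))"
      using flux unfolding D_eq[OF False] c_def[symmetric] ck Y_def[symmetric] w_def[symmetric]
      by (simp add: mult_ac abs_le_iff)
    then have "(k powr (p - 1) / L) * D x
        \<ge> (k powr (p - 1) / L) * (L * w * p * (k * Y powr p) - L * w * p * (X * Y powr (p - 1)))"
      using pos by (intro mult_left_mono) auto
    also have "(k powr (p - 1) / L) * (L * w * p * (k * Y powr p) - L * w * p * (X * Y powr (p - 1)))
      = - (w * (p * k powr (p - 1) * (X * Y powr (p - 1) - k * Y powr p)))"
      using pos by (simp add: field_simps)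
    finally have "(k powr (p - 1) / L) * D x
      \<ge> - (w * (p * k powr (p - 1) * (X * Y powr (p - 1) - k * Y powr p)))" .
    moreover have "w * (p * k powr (p - 1) * (X * Y powr (p - 1) - k * Y powr p))
        \<le> w * (X powr p - k powr p * Y powr p)"
      using powr_tangent_bound[OF p nn(1,2) pos(3)] nn(3) by (intro mult_left_mono) auto
    ultimately show ?thesis unfolding A0' A1' by (simp add: algebra_simps)
  qed
  have "k powr p * (\<integral>x. A0 x \<partial>lborel) = (\<integral>x. k powr p * A0 x \<partial>lborel)"
    by simp
  also have "\<dots> \<le> (\<integral>x. A1 x + (k powr (p - 1) / L) * D x \<partial>lborel)"
    using A0 A1 D(1) pointwise
    by (intro integral_mono Bochner_Integration.integrable_add integrable_mult_right) auto
  also have "\<dots> = (\<integral>x. A1 x \<partial>lborel)"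
    using A1 D by simp
  finally have "ennreal (k powr p * (\<integral>x. A0 x \<partial>lborel)) \<le> ennreal (\<integral>x. A1 x \<partial>lborel)"
    by (rule ennreal_leI)
  moreover have "(\<integral>\<^sup>+ x. ennreal (A0 x) \<partial>lborel) = ennreal (\<integral>x. A0 x \<partial>lborel)"
    "(\<integral>\<^sup>+ x. ennreal (A1 x) \<partial>lborel) = ennreal (\<integral>x. A1 x \<partial>lborel)"
    by (intro nn_integral_eq_integral A0 A1 AE_I2; simp add: A0_def A1_def)+
  ultimately have "ennreal (k powr p) * (\<integral>\<^sup>+ x. ennreal (A0 x) \<partial>lborel)
      \<le> (\<integral>\<^sup>+ x. ennreal (A1 x) \<partial>lborel)"
    by (simp add: ennreal_mult')
  then show ?thesis unfolding A0_def A1_def G_def k_def c_def L_def .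
qed

end

subsection \<open>The lower bounds\<close>

lemma hardy_const_geI:
  assumes "c \<ge> 0"
    and "\<And>u. u \<in> test_funs \<Longrightarrow>
      ennreal c * (\<integral>\<^sup>+ x. ennreal (\<bar>u x\<bar> powr p / d x powr (p * \<theta>)) \<partial>lborel)
      \<le> (\<integral>\<^sup>+ x. ennreal (norm (horiz_grad B u x) powr p / d x powr (p * (\<theta> - 1))) \<partial>lborel)"
  shows "ereal c \<le> hardy_const B d p \<theta>"
  unfolding hardy_const_def using assms by (intro Sup_upper) blast

section \<open>From the vector field to the Hardy constant\<close>

text \<open>Any positive upper bound \<open>M\<close> for the cubic on \<open>[0, 1]\<close> is
  allowed, so both ranges of the theorem follow by inserting the appropriate maximum.\<close>

lemma hardy_const_rhoB_ge:
  fixes B :: "real^'m^'m" and p \<theta> s M :: real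
  assumes skew: "skew_symmetric B" and ker: "\<forall>z. B *v z = 0 \<longrightarrow> z = 0" and p: "p > 1"
    and s: "s * (real CARD('m) + 2 - p * \<theta>) = p * \<theta>"
    and M: "M > 0" "\<And>y. 0 \<le> y \<Longrightarrow> y \<le> 1 \<Longrightarrow> y * (1 + (2 * s + s^2) * y^2) \<le> M"
  shows "ereal ((lambda_min B / 4) powr (p/2) * (real CARD('m) / p) powr p / M powr (p/2))
    \<le> hardy_const B (rhoB B) p \<theta>"
proof -
  define S where "S = matrix_sqrt (- (B ** B))"
  note S = sqrt_neg_skew_square[OF skew ker, folded S_def]
  obtain J :: "real^'m^'m" where J: "skew_symmetric J"
    "\<And>z. (J *v z) \<bullet> (J *v z) = z \<bullet> z"
    "\<And>z. (B *v z) \<bullet> (J *v z) = z \<bullet> (S *v z)" "\<And>z. (S *v z) \<bullet> (J *v z) = 0"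
    using ex_complex_structure[OF skew ker S(1-3)] by metis
  interpret hardy_structure B S J "lambda_min B" "p * \<theta>" s
    by unfold_locales (use skew S(1,4,5) J s in \<open>simp_all add: pos_semidef_def\<close>)
  have rho: "rhoB B x = P x powr (1/4)" for x
    unfolding P_def r_def
    unfolding S_def by (rule rhoB_eq) (use S(1) in \<open>simp add: pos_semidef_def S_def\<close>)
  let ?c = "real CARD('m) / (p * sqrt (4 * M / lambda_min B))"
  have "?c powr p = (real CARD('m) / p) powr p / (M / (lambda_min B / 4)) powr (p/2)"
    using p M(1) S(4)
    by (simp add: powr_divide powr_mult powr_half_sqrt[symmetric] powr_powr mult.commute)
  also have "\<dots> = (lambda_min B / 4) powr (p/2) * (real CARD('m) / p) powr p / M powr (p/2)"
    using p M(1) S(4) by (subst (2) powr_divide) simp_all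
  finally have c: "?c powr p = \<dots>" .
  have eq: "p * (\<theta> - 1) = p * \<theta> - p" by (simp add: algebra_simps)
  have "ereal (?c powr p) \<le> hardy_const B (rhoB B) p \<theta>"
    by (rule hardy_const_geI) (simp, unfold eq, rule hardy_inequality[OF p _ M rho])
  then show ?thesis unfolding c .
qed

section \<open>Maxima of the cubic\<close>

text \<open>The difference of the two sides is \<open>(1 - y) * (1 + a * (1 + y + y^2))\<close>. The
  last factor is nonnegative because \<open>1 + y + y^2 \<le> 3\<close>, whence the threshold
  \<open>- 1/3\<close>.\<close>

lemma cubic_le_at_1:
  fixes a y :: real
  assumes "a \<ge> - 1/3" "0 \<le> y" "y \<le> 1"
  shows "y * (1 + a * y^2) \<le> 1 + a"
proof -
  define w where "w = 1 + y + y^2"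
  have "y^2 \<le> 1" using assms by (simp add: power_le_one)
  then have "w \<le> 3" "w \<ge> 0" using assms by (simp_all add: w_def)
  moreover from this have "a * w \<ge> (- 1/3) * w"
    using assms by (intro mult_right_mono) auto
  ultimately have "1 + a * w \<ge> 0" by linarith
  then have "(1 - y) * (1 + a * w) \<ge> 0" using assms by simp
  then show ?thesis by (simp add: w_def algebra_simps power2_eq_square)
qed

text \<open>With the critical point \<open>q = 1 / sqrt (3 * e)\<close>, a double zero of the
  difference of the two sides, that difference factors as
  \<open>e * ((y - q)^2 * (y + 2 * q))\<close>.\<close>

lemma cubic_le_at_critical:
  fixes e y :: real
  assumes "e > 0" "y \<ge> 0"
  shows "y * (1 - e * y^2) \<le> 2 / (3 * sqrt (3 * e))"
proof -
  define q where "q = 1 / sqrt (3 * e)"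
  have q: "q > 0" "3 * e * q^2 = 1" using assms by (auto simp: q_def power_divide)
  have "0 \<le> e * ((y - q)^2 * (y + 2 * q))" using assms q by simp
  also have "\<dots> = e * y^3 - (3 * e * q^2) * y + 2 * (3 * e * q^2) * q / 3"
    by (simp add: field_simps power2_eq_square power3_eq_cube)
  finally show ?thesis
    unfolding q by (simp add: q_def algebra_simps power2_eq_square power3_eq_cube)
qed

theorem theorem1p7:
  fixes B :: "real^'m^'m" and p \<theta> :: real
  assumes "skew_symmetric B"
    and "\<forall>z. B *v z = 0 \<longrightarrow> z = 0"
    and "p \<ge> 2"
  defines "Q \<equiv> real CARD('m) + 2"
  shows "hardy_const B (rhoB B) p \<theta> \<ge>
           ereal (if (1 - sqrt (3/2)) * Q \<le> p * \<theta> \<and> p * \<theta> \<le> (1 + sqrt (3/2)) * Q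
                  then (lambda_min B / 4) powr (p/2) * \<bar>(Q - p * \<theta>) / p\<bar> powr p
                         * \<bar>(Q - 2) / Q\<bar> powr p
                  else (lambda_min B / 4) powr (p/2) * (3/2) powr (p/2)
                         * (3 * p * \<theta> * (p * \<theta> - 2 * Q)) powr (p/4)
                         / \<bar>p * \<theta> - Q\<bar> powr (p/2) * \<bar>(Q - 2) / p\<bar> powr p)
         \<and> hardy_const B (rhoB B) 2 1 \<ge> ereal (lambda_min B / 4 * (Q - 2)^4 / (4 * Q^2))"
proof -
  have m: "real CARD('m) = Q - 2" "Q > 2" by (simp_all add: Q_def)
  \<comment> \<open>For \<open>b \<noteq> Q\<close> and \<open>s = b / (Q - b)\<close>, the squared
    form says \<open>(1 + s)^2 \<ge> 2/3\<close>, that is \<open>2 * s + s^2 \<ge> - 1/3\<close>,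
    the hypothesis of \<open>cubic_le_at_1\<close>.\<close>
  have range_iff: "(1 - sqrt (3/2)) * Q \<le> b \<and> b \<le> (1 + sqrt (3/2)) * Q \<longleftrightarrow> (Q - b)^2 \<le> 3/2 * Q^2"
    for b
  proof -
    have "(Q - b)^2 \<le> 3/2 * Q^2 \<longleftrightarrow> \<bar>Q - b\<bar> \<le> \<bar>sqrt (3/2) * Q\<bar>"
      by (simp add: abs_le_square_iff power_mult_distrib)
    also have "\<bar>sqrt (3/2) * Q\<bar> = sqrt (3/2) * Q" using m by simp
    finally show ?thesis by (auto simp: algebra_simps)
  qed
  \<comment> \<open>Stated for arbitrary \<open>p\<close> and \<open>\<theta>\<close> so that it
    also yields the special case \<open>p = 2\<close>, \<open>\<theta> = 1\<close>.\<close>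
  have case1: "ereal ((lambda_min B / 4) powr (p/2) * \<bar>(Q - p * \<theta>) / p\<bar> powr p * \<bar>(Q - 2) / Q\<bar> powr p)
      \<le> hardy_const B (rhoB B) p \<theta>"
    if p: "p \<ge> 2" and rng: "(Q - p * \<theta>)^2 \<le> 3/2 * Q^2" for p \<theta> :: real
  proof (cases "p * \<theta> = Q")
    \<comment> \<open>Here no \<open>s\<close> with
      \<open>s * (Q - p * \<theta>) = p * \<theta>\<close> exists, but the claimed constant is
      \<open>0\<close>.\<close>
    case True
    then show ?thesis using p hardy_const_geI[of 0 p "rhoB B" \<theta> B] by (simp add: zero_ereal_def)
  next
    case False
    define s where "s = p * \<theta> / (Q - p * \<theta>)"
    \<comment> \<open>This equals \<open>(1 + s)^2\<close>, the value of the cubic at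
      \<open>y = 1\<close>.\<close>
    define M where "M = (Q / (Q - p * \<theta>))^2"
    have "1 + s = Q / (Q - p * \<theta>)" using False by (simp add: s_def field_simps)
    then have M_eq: "M = 1 + (2 * s + s^2)"
      by (simp add: M_def flip: \<open>1 + s = _\<close>) (simp add: power2_eq_square algebra_simps)
    have "M \<ge> 2/3"
      using rng False by (simp add: M_def power_divide le_divide_eq)
    then have a: "2 * s + s^2 \<ge> - 1/3" using M_eq by linarith
    have "s * (real CARD('m) + 2 - p * \<theta>) = p * \<theta>" using False by (simp add: m s_def)
    moreover have "M > 0" using \<open>M \<ge> 2/3\<close> by linarith
    moreover have "y * (1 + (2 * s + s^2) * y^2) \<le> M" if "0 \<le> y" "y \<le> 1" for y
      using cubic_le_at_1[OF a that] by (simp add: M_eq)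
    ultimately have "ereal ((lambda_min B / 4) powr (p/2) * ((Q - 2) / p) powr p / M powr (p/2))
        \<le> hardy_const B (rhoB B) p \<theta>"
      using hardy_const_rhoB_ge[OF assms(1,2), of p s \<theta> M] p m by simp
    moreover have "((Q - 2) / p) powr p / M powr (p/2) = \<bar>(Q - p * \<theta>) / p\<bar> powr p * \<bar>(Q - 2) / Q\<bar> powr p"
    proof -
      have "M powr (p/2) = \<bar>Q / (Q - p * \<theta>)\<bar> powr p"
      proof -
        have "M = \<bar>Q / (Q - p * \<theta>)\<bar> powr 2"
        using False m by (simp add: M_def power_divide)
        then show ?thesis by (simp only: powr_powr) simp
      qed
      then show ?thesis using False m p
        by (simp add: powr_mult[symmetric] powr_divide[symmetric] abs_divide abs_mult field_simps)
    qed
    ultimately show ?thesis by (simp only: mult.assoc flip: times_divide_eq_right)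
  qed
  have case2: "ereal ((lambda_min B / 4) powr (p/2) * (3/2) powr (p/2)
        * (3 * p * \<theta> * (p * \<theta> - 2 * Q)) powr (p/4)
        / \<bar>p * \<theta> - Q\<bar> powr (p/2) * \<bar>(Q - 2) / p\<bar> powr p)
      \<le> hardy_const B (rhoB B) p \<theta>"
    if rng: "\<not> (Q - p * \<theta>)^2 \<le> 3/2 * Q^2"
  proof -
    define s where "s = p * \<theta> / (Q - p * \<theta>)"
    have ne: "Q - p * \<theta> \<noteq> 0" using rng by auto
    \<comment> \<open>\<open>T = (Q - p * \<theta>)^2 - Q^2\<close> is positive outside the range,
      and \<open>e\<close> is \<open>- (2 * s + s^2)\<close>; the cubic thus takes the form of
      \<open>cubic_le_at_critical\<close>.\<close>
    define T where "T = p * \<theta> * (p * \<theta> - 2 * Q)"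
    define e where "e = T / (Q - p * \<theta>)^2"
    have T: "T = (Q - p * \<theta>)^2 - Q^2" by (simp add: T_def power2_eq_square algebra_simps)
    have "Q^2 > 0" using m by simp
    then have Tpos: "T > 0" using rng unfolding T by linarith
    have epos: "e > 0" using Tpos ne by (simp add: e_def)
    have "1 + s = Q / (Q - p * \<theta>)" using ne by (simp add: s_def field_simps)
    then have "1 + (2 * s + s^2) = Q^2 / (Q - p * \<theta>)^2"
      by (simp add: flip: power_divide \<open>1 + s = _\<close>) (simp add: power2_eq_square algebra_simps)
    then have a: "2 * s + s^2 = - e"
      using ne by (simp add: e_def T diff_divide_distrib)
    define M where "M = 2 / (3 * sqrt (3 * e))"
    have "s * (real CARD('m) + 2 - p * \<theta>) = p * \<theta>" using ne by (simp add: m s_def)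
    moreover have "M > 0" using epos by (simp add: M_def)
    moreover have "y * (1 + (2 * s + s^2) * y^2) \<le> M" if "0 \<le> y" "y \<le> 1" for y
      using cubic_le_at_critical[OF epos that(1)] by (simp add: a M_def)
    ultimately have "ereal ((lambda_min B / 4) powr (p/2) * ((Q - 2) / p) powr p / M powr (p/2))
        \<le> hardy_const B (rhoB B) p \<theta>"
      using hardy_const_rhoB_ge[OF assms(1,2), of p s \<theta> M] assms(3) m by simp
    moreover have M_inv: "1 / M powr (p/2) = (3/2) powr (p/2)
        * (3 * p * \<theta> * (p * \<theta> - 2 * Q)) powr (p/4) / \<bar>p * \<theta> - Q\<bar> powr (p/2)"
    proof -
      have inv: "1 / M = 3/2 * sqrt (3 * T) / \<bar>p * \<theta> - Q\<bar>"
        by (simp add: M_def e_def real_sqrt_divide abs_minus_commute)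
      have "1 / M powr (p/2) = (1 / M) powr (p/2)"
        using \<open>M > 0\<close> by (simp add: powr_divide)
      also have "\<dots> = (3/2 * sqrt (3 * T) / \<bar>p * \<theta> - Q\<bar>) powr (p/2)"
        by (simp only: inv)
      also have "\<dots> = (3/2) powr (p/2) * sqrt (3 * T) powr (p/2) / \<bar>p * \<theta> - Q\<bar> powr (p/2)"
        using Tpos by (simp only: powr_mult powr_divide)
      also have "sqrt (3 * T) powr (p/2) = (3 * T) powr (p/4)"
        using Tpos by (simp add: powr_half_sqrt[symmetric] powr_powr)
      finally show ?thesis by (simp add: T_def mult.assoc)
    qed
    moreover have "((Q - 2) / p) powr p = \<bar>(Q - 2) / p\<bar> powr p" using m assms(3) by simp
    moreover have "A * q / W = A * h * t / v * q" if "1 / W = h * t / v" for A q W h t v :: real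
    proof -
      have "A * q / W = A * q * (1 / W)" by simp
      then show ?thesis by (simp add: that)
    qed
    from this[OF M_inv] have "(lambda_min B / 4) powr (p/2) * ((Q - 2) / p) powr p / M powr (p/2)
      = (lambda_min B / 4) powr (p/2) * (3/2) powr (p/2)
        * (3 * p * \<theta> * (p * \<theta> - 2 * Q)) powr (p/4)
        / \<bar>p * \<theta> - Q\<bar> powr (p/2) * ((Q - 2) / p) powr p" .
    ultimately show ?thesis by (simp only:)
  qed
  \<comment> \<open>The product \<open>2 * 1\<close> is \<open>p * \<theta>\<close> at
    \<open>p = 2\<close>, \<open>\<theta> = 1\<close>, which lies in the first range because
    \<open>Q > 2\<close>.\<close>
  have "(Q - 2 * 1)^2 \<le> 3/2 * Q^2"
  proof -
    have "(Q - 2)^2 \<le> Q^2" using m by (intro power_mono) auto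
    then show ?thesis unfolding mult_1_right using zero_le_power2[of Q] by linarith
  qed
  from case1[OF order_refl this]
  have "ereal (lambda_min B / 4 * (Q - 2)^4 / (4 * Q^2)) \<le> hardy_const B (rhoB B) 2 1"
    using sqrt_neg_skew_square(4)[OF assms(1,2)] m
    by (simp add: power_divide power4_eq_xxxx power2_eq_square mult.assoc)
  with case1[OF assms(3)] case2 show ?thesis
    unfolding range_iff by (cases "(Q - p * \<theta>)^2 \<le> 3/2 * Q^2") simp_all
qed

end
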